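(* Let $\mathbf d=(d_1,\ldots,d_n)$ be a sequence of positive integers (depending on $n$) with $\sum_i d_i$ even, and suppose $M_2=o(M_1^{9/8})$ as $n\to\infty$. Put $\lambda_{i,j}=d_id_j/M_1$ and $\xi=M_2^4/M_1^{9/2}+M_2^{3/2}/M_1^2+1/M_1$. Then $\xi=o(1)$ and \[ g(\mathbf d)=\big(1+O(\sqrt{\xi})\big)\frac{|\Phi|}{\prod_{i=1}^n d_i!}\exp\left(-\frac{M_1}{2}+\frac{M_2}{2M_1}-\frac{M_3}{3M_1^2}+\frac34+\sum_{1\le i<j\le n}\log(1+\lambda_{i,j})\right). \]
   Context: $g(\mathbf d)$ denotes the number of simple graphs on vertex set $\{1,\ldots,n\}$ in which vertex $i$ has degree $d_i$. For an integer $k\ge1$, $[x]_k=x(x-1)\cdots(x-k+1)$ and $M_k=\sum_{i=1}^n[d_i]_k$ (so $M_1=\sum_i d_i$). $|\Phi|=\frac{M_1!}{2^{M_1/2}(M_1/2)!}$ is the number of perfect matchings on $M_1$ points. All asymptotics are as $n\to\infty$, and $O(\cdot)$ constants are independent of $n$ and $\mathbf d$. *)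

theory Defs
  imports Complex_Main "HOL-Library.Landau_Symbols"
begin

definition fall :: "nat \<Rightarrow> nat \<Rightarrow> real" where
  "fall x k = (\<Prod>j<k. (real x - real j))"

definition pairs :: "nat \<Rightarrow> nat set set" where
  "pairs n = {e. \<exists>i j. i \<in> {1..n} \<and> j \<in> {1..n} \<and> i \<noteq> j \<and> e = {i, j}}"

definition num_graphs :: "nat \<Rightarrow> (nat \<Rightarrow> nat) \<Rightarrow> nat" where
  "num_graphs n d = card {E. E \<subseteq> pairs n \<and> (\<forall>i\<in>{1..n}. card {e\<in>E. i \<in> e} = d i)}"

definition Mk :: "nat \<Rightarrow> (nat \<Rightarrow> nat) \<Rightarrow> nat \<Rightarrow> real" where
  "Mk n d k = (\<Sum>i\<in>{1..n}. fall (d i) k)"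

text \<open>|Phi| = M1! / (2^(M1/2) (M1/2)!), number of perfect matchings on M1 points.\<close>
definition Phi_card :: "nat \<Rightarrow> real" where
  "Phi_card m = fact m / (2 ^ (m div 2) * fact (m div 2))"

definition xi :: "nat \<Rightarrow> (nat \<Rightarrow> nat) \<Rightarrow> real" where
  "xi n d = Mk n d 2 ^ 4 / Mk n d 1 powr (9/2) + Mk n d 2 powr (3/2) / Mk n d 1 ^ 2
            + 1 / Mk n d 1"

definition lam :: "nat \<Rightarrow> (nat \<Rightarrow> nat) \<Rightarrow> nat \<Rightarrow> nat \<Rightarrow> real" where
  "lam n d i j = real (d i) * real (d j) / Mk n d 1"

definition approx_g :: "nat \<Rightarrow> (nat \<Rightarrow> nat) \<Rightarrow> real" where
  "approx_g n d = Phi_card (\<Sum>i\<in>{1..n}. d i) / (\<Prod>i\<in>{1..n}. fact (d i)) *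
     exp (- Mk n d 1 / 2 + Mk n d 2 / (2 * Mk n d 1) - Mk n d 3 / (3 * Mk n d 1 ^ 2) + 3/4
          + (\<Sum>(i,j)\<in>{(i,j). 1 \<le> i \<and> i < j \<and> j \<le> n}. ln (1 + lam n d i j)))"

end

theory Submission
  imports Defs "HOL-Analysis.Convex"
begin

text \<open>
  Write \<open>N = M1\<close> and pad the degree sequence with zeros to \<open>N\<close> vertices. It then arises from the
  sequence \<open>(1, \<dots>, 1)\<close>, whose graphs are the perfect matchings, by repeatedly merging a leaf \<open>b\<close> into a
  vertex \<open>a\<close>. The graphs destroyed by a merger are those in which \<open>b\<close> is adjacent to \<open>a\<close> or has a
  common neighbour with \<open>a\<close>, so each merger multiplies the number of graphs, up to the factor from
  the factorials, by \<open>1 - P\<close>, where \<open>P\<close> is the probability of this event. Switchings show that an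
  edge \<open>uv\<close> is present with probability about \<open>\<lambda> / (1 + \<lambda>)\<close>, where \<open>\<lambda> = d\<^sub>u d\<^sub>v / N\<close>, and so determine \<open>P\<close>;
  the resulting value of \<open>ln (1 - P)\<close> agrees with the increment of the exponent in the formula. With
  \<open>D\<^sup>2 = M1 + M2\<close>, the relative error in \<open>P\<close> is \<open>O(D\<^sup>3 / N\<^sup>2)\<close> and the sum of all \<open>P\<close> is
  \<open>O(D\<^sup>4 / N\<^sup>2)\<close>. The total error \<open>O(D\<^sup>7 / N\<^sup>4)\<close> is bounded by a multiple of \<open>sqrt \<xi>\<close>.
\<close>

section \<open>Graphs with given degrees\<close>

text \<open>The number N and the vertex set stay fixed along the chain of mergers and the sum of
  squares only grows, so one pair (N, D) fitting the final sequence controls all intermediate ones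
  and the errors telescope. The obstacle is accuracy: edge probabilities are needed up to the
  relative error D^3/N^2, but a vertex may start about D^(3/2) two-paths, so a worst-case switching
  count only yields its square root. The estimate is therefore bootstrapped. The worst case, kept
  below N/20, bounds every edge probability by 2 \<lambda>, also given up to three other edges.
  These crude bounds show that obstructions are rare on average, which sharpens the same count. For
  a leaf merged into a vertex of degree k, the main part of P is Q = k/N + sum of (t/N) m/(1+m) over
  the other vertices x, with t = d_x and m = (t-1)k/N: the edge ab and the paths b-x-a. The
  logarithms of the exponent change by about - Q - k/N, and the increment k/N of M2/(2 M1) removes
  the surplus.\<close>

definition edge_pairs :: "'a set \<Rightarrow> 'a set set" where
  "edge_pairs V = {e. \<exists>i j. i \<in> V \<and> j \<in> V \<and> i \<noteq> j \<and> e = {i, j}}"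

definition deg :: "'a set set \<Rightarrow> 'a \<Rightarrow> nat" where
  "deg E i = card {e \<in> E. i \<in> e}"

definition graphs :: "'a set \<Rightarrow> ('a \<Rightarrow> nat) \<Rightarrow> 'a set set set" where
  "graphs V d = {E. E \<subseteq> edge_pairs V \<and> (\<forall>i\<in>V. deg E i = d i)}"

definition nbrs :: "'a set set \<Rightarrow> 'a \<Rightarrow> 'a set" where
  "nbrs E u = {v. {u, v} \<in> E}"

lemma edge_pairs_iff [simp]: "{u, v} \<in> edge_pairs V \<longleftrightarrow> u \<in> V \<and> v \<in> V \<and> u \<noteq> v"
  by (auto simp: edge_pairs_def doubleton_eq_iff)

lemma finite_edge_pairs: "finite V \<Longrightarrow> finite (edge_pairs V)"
  by (rule finite_subset[of _ "Pow V"]) (auto simp: edge_pairs_def)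

lemma finite_graphs: "finite V \<Longrightarrow> finite (graphs V d)"
  by (rule finite_subset[of _ "Pow (edge_pairs V)"]) (auto simp: graphs_def finite_edge_pairs)

lemma graphs_edgeD:
  assumes "E \<in> graphs V d" "{u, v} \<in> E"
  shows "u \<in> V" "v \<in> V" "u \<noteq> v"
  using assms edge_pairs_iff[of u v V] unfolding graphs_def by blast+

lemma graphs_edgeE:
  assumes "E \<in> graphs V d" "e \<in> E"
  obtains i j where "i \<in> V" "j \<in> V" "i \<noteq> j" "e = {i, j}"
proof -
  have "e \<in> edge_pairs V" using assms by (auto simp: graphs_def)
  then show thesis using that unfolding edge_pairs_def by blast
qed

lemma graphs_finite: "finite V \<Longrightarrow> E \<in> graphs V d \<Longrightarrow> finite E"
  by (auto simp: graphs_def intro: finite_subset finite_edge_pairs)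

lemma nbrs_subset: "E \<in> graphs V d \<Longrightarrow> nbrs E u \<subseteq> V"
  by (auto simp: nbrs_def dest: graphs_edgeD)

lemma card_nbrs:
  assumes "E \<in> graphs V d" "u \<in> V"
  shows "card (nbrs E u) = d u"
proof -
  have "bij_betw (\<lambda>v. {u, v}) (nbrs E u) {e \<in> E. u \<in> e}"
    unfolding bij_betw_def
  proof
    show "inj_on (\<lambda>v. {u, v}) (nbrs E u)"
      by (auto simp: inj_on_def doubleton_eq_iff)
    show "(\<lambda>v. {u, v}) ` nbrs E u = {e \<in> E. u \<in> e}"
    proof (intro equalityI subsetI)
      fix e assume e: "e \<in> {e \<in> E. u \<in> e}"
      then obtain i j where ij: "e = {i, j}"
        using assms by (auto simp: graphs_def edge_pairs_def)
      with e have "e = {u, j} \<or> e = {u, i}" by auto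
      with e show "e \<in> (\<lambda>v. {u, v}) ` nbrs E u" by (auto simp: nbrs_def)
    qed (auto simp: nbrs_def)
  qed
  then have "card (nbrs E u) = deg E u" by (simp add: deg_def bij_betw_same_card)
  with assms show ?thesis by (simp add: graphs_def)
qed

lemma deg_exchange:
  assumes "finite E" "finite A" "R \<subseteq> E" "A \<inter> E = {}"
  shows "deg ((E - R) \<union> A) i + deg R i = deg E i + deg A i"
proof -
  have 1: "deg ((E - R) \<union> A) i = deg (E - R) i + deg A i"
    unfolding deg_def using assms by (subst card_Un_disjoint[symmetric]) (auto intro: arg_cong[where f=card])
  have 2: "deg E i = deg (E - R) i + deg R i"
    unfolding deg_def using assms finite_subset[OF assms(3,1)]
    by (subst card_Un_disjoint[symmetric]) (auto intro: arg_cong[where f=card])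
  from 1 2 show ?thesis by simp
qed

lemma deg_two: "e \<noteq> f \<Longrightarrow> deg {e, f} i = of_bool (i \<in> e) + of_bool (i \<in> f)"
proof -
  have "{e' \<in> {e, f}. i \<in> e'} = (if i \<in> e then {e} else {}) \<union> (if i \<in> f then {f} else {})" by auto
  then show "e \<noteq> f \<Longrightarrow> deg {e, f} i = of_bool (i \<in> e) + of_bool (i \<in> f)" by (simp add: deg_def)
qed

lemma deg_one: "deg {e} i = of_bool (i \<in> e)"
proof -
  have "{e' \<in> {e}. i \<in> e'} = (if i \<in> e then {e} else {})" by auto
  then show ?thesis by (simp add: deg_def)
qed

text \<open>Serves all local modifications: the switchings, where \<open>d'\<close> is
  \<open>d\<close>, and the merging of a leaf, where two degrees change. The degree condition is
  balanced by sums on both sides because degrees are natural numbers.\<close>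

lemma graphs_exchange:
  assumes "finite V" "E \<in> graphs V d" "R \<subseteq> E" "A \<inter> E = {}" "A \<subseteq> edge_pairs V"
    and "\<And>i. i \<in> V \<Longrightarrow> d' i + deg R i = d i + deg A i"
  shows "(E - R) \<union> A \<in> graphs V d'"
proof -
  have "deg ((E - R) \<union> A) i = d' i" if "i \<in> V" for i
    using deg_exchange[of E A R i] assms(2-5) assms(6)[OF that] that graphs_finite[OF assms(1,2)]
      finite_subset[OF assms(5) finite_edge_pairs[OF assms(1)]]
    by (simp add: graphs_def)
  with assms show ?thesis by (auto simp: graphs_def)
qed

section \<open>Switchings\<close>

definition containing :: "'a set \<Rightarrow> ('a \<Rightarrow> nat) \<Rightarrow> 'a set set \<Rightarrow> 'a set set set" where
  "containing V d H = {E \<in> graphs V d. H \<subseteq> E}"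

text \<open>
  A switching replaces the edges \<open>uv\<close> and \<open>xy\<close> by \<open>ux\<close> and \<open>vy\<close>; the edges in \<open>H\<close> are left
  untouched. \<open>fwd\<close> collects the admissible pairs \<open>(x, y)\<close> in a graph containing \<open>uv\<close>, and
  \<open>bwd\<close> those of the inverse operation.
\<close>

definition fwd :: "'a set set \<Rightarrow> 'a \<Rightarrow> 'a \<Rightarrow> 'a set set \<Rightarrow> ('a \<times> 'a) set" where
  "fwd H u v E = {(x, y). {x, y} \<in> E - H \<and> x \<notin> {u, v} \<and> y \<notin> {u, v} \<and> {u, x} \<notin> E \<and> {v, y} \<notin> E}"

definition bwd :: "'a set set \<Rightarrow> 'a \<Rightarrow> 'a \<Rightarrow> 'a set set \<Rightarrow> ('a \<times> 'a) set" where
  "bwd H u v E = {(x, y). {u, x} \<in> E - H \<and> {v, y} \<in> E - H \<and> x \<noteq> y \<and> {x, y} \<notin> E}"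

lemma finite_fwd: "finite V \<Longrightarrow> E \<in> graphs V d \<Longrightarrow> finite (fwd H u v E)"
  by (rule finite_subset[of _ "V \<times> V"]) (auto simp: fwd_def dest: graphs_edgeD)

lemma finite_bwd: "finite V \<Longrightarrow> E \<in> graphs V d \<Longrightarrow> finite (bwd H u v E)"
  by (rule finite_subset[of _ "V \<times> V"]) (auto simp: bwd_def dest: graphs_edgeD)

text \<open>Both sides count pairs of a graph and a switching. Keeping the ordered pair
  \<open>(x, y)\<close> next to the graph makes the operation invertible, so each edge
  \<open>xy\<close> may offer two switchings, one per orientation. No removed edge lies in
  \<open>H\<close>, hence \<open>H \<subseteq> E\<close> survives in both directions.\<close>

lemma switching_count:
  assumes V: "finite V" "u \<in> V" "v \<in> V" "u \<noteq> v" and H: "{u, v} \<notin> H"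
  shows "(\<Sum>E\<in>containing V d (insert {u, v} H). card (fwd H u v E)) =
         (\<Sum>E\<in>containing V d H - containing V d (insert {u, v} H). card (bwd H u v E))"
proof -
  let ?A = "containing V d (insert {u, v} H)"
  let ?B = "containing V d H - containing V d (insert {u, v} H)"
  let ?f = "\<lambda>(E, x, y). ((E - {{u, v}, {x, y}}) \<union> {{u, x}, {v, y}}, x, y)"
  let ?g = "\<lambda>(E, x, y). ((E - {{u, x}, {v, y}}) \<union> {{u, v}, {x, y}}, x, y)"
  have fin: "finite ?A" "finite ?B"
    using finite_graphs[OF V(1)] by (auto simp: containing_def)
  have ff: "((E - {{u, v}, {x, y}}) \<union> {{u, x}, {v, y}}, x, y) \<in> Sigma ?B (bwd H u v) \<and>
      (E - {{u, v}, {x, y}}) \<union> {{u, x}, {v, y}} - {{u, x}, {v, y}} \<union> {{u, v}, {x, y}} = E"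
    if "E \<in> ?A" and "(x, y) \<in> fwd H u v E" for E x y
  proof -
    have E: "E \<in> graphs V d" "H \<subseteq> E" "{u, v} \<in> E" using that by (auto simp: containing_def)
    have xy: "{x, y} \<in> E" "{x, y} \<notin> H" "x \<notin> {u, v}" "y \<notin> {u, v}" "{u, x} \<notin> E" "{v, y} \<notin> E"
      using that by (auto simp: fwd_def)
    have xyV: "x \<in> V" "y \<in> V" "x \<noteq> y" using graphs_edgeD[OF E(1) xy(1)] by auto
    have G: "(E - {{u, v}, {x, y}}) \<union> {{u, x}, {v, y}} \<in> graphs V d"
    proof (rule graphs_exchange[OF V(1) E(1)])
      fix i assume "i \<in> V"
      show "d i + deg {{u, v}, {x, y}} i = d i + deg {{u, x}, {v, y}} i"
        using xy xyV V by (subst (1 2) deg_two) (auto simp: doubleton_eq_iff)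
    qed (use E xy xyV V in auto)
    show ?thesis
    proof
      show "((E - {{u, v}, {x, y}}) \<union> {{u, x}, {v, y}}, x, y) \<in> Sigma ?B (bwd H u v)"
        using G E xy xyV V H by (auto simp: containing_def bwd_def doubleton_eq_iff)
      show "(E - {{u, v}, {x, y}}) \<union> {{u, x}, {v, y}} - {{u, x}, {v, y}} \<union> {{u, v}, {x, y}} = E"
        using E xy by auto
    qed
  qed
  have gg: "((E - {{u, x}, {v, y}}) \<union> {{u, v}, {x, y}}, x, y) \<in> Sigma ?A (fwd H u v) \<and>
      (E - {{u, x}, {v, y}}) \<union> {{u, v}, {x, y}} - {{u, v}, {x, y}} \<union> {{u, x}, {v, y}} = E"
    if "E \<in> ?B" and "(x, y) \<in> bwd H u v E" for E x y
  proof -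
    have E: "E \<in> graphs V d" "H \<subseteq> E" "{u, v} \<notin> E" using that by (auto simp: containing_def)
    have xy: "{u, x} \<in> E" "{v, y} \<in> E" "{u, x} \<notin> H" "{v, y} \<notin> H" "x \<noteq> y" "{x, y} \<notin> E"
      using that by (auto simp: bwd_def)
    have xyV: "x \<in> V" "y \<in> V" "x \<noteq> u" "y \<noteq> v"
      using graphs_edgeD[OF E(1) xy(1)] graphs_edgeD[OF E(1) xy(2)] by auto
    \<comment> \<open>\<open>bwd\<close> does not list these conditions: they follow from the
      absence of \<open>uv\<close>.\<close>
    have xy2: "x \<noteq> v" "y \<noteq> u" using E xy by (auto simp: insert_commute)
    have G: "(E - {{u, x}, {v, y}}) \<union> {{u, v}, {x, y}} \<in> graphs V d"
    proof (rule graphs_exchange[OF V(1) E(1)])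
      fix i assume "i \<in> V"
      show "d i + deg {{u, x}, {v, y}} i = d i + deg {{u, v}, {x, y}} i"
        using xy xy2 xyV V by (subst (1 2) deg_two) (auto simp: doubleton_eq_iff)
    qed (use E xy xyV V in auto)
    show ?thesis
    proof
      show "((E - {{u, x}, {v, y}}) \<union> {{u, v}, {x, y}}, x, y) \<in> Sigma ?A (fwd H u v)"
        using G E xy xy2 xyV V H by (auto simp: containing_def fwd_def doubleton_eq_iff)
      show "(E - {{u, x}, {v, y}}) \<union> {{u, v}, {x, y}} - {{u, v}, {x, y}} \<union> {{u, x}, {v, y}} = E"
        using E xy by auto
    qed
  qed
  have "bij_betw ?f (Sigma ?A (fwd H u v)) (Sigma ?B (bwd H u v))"
  proof (rule bij_betw_byWitness[where f' = ?g])
    show "\<forall>p\<in>Sigma ?A (fwd H u v). ?g (?f p) = p"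
    proof
      fix p assume "p \<in> Sigma ?A (fwd H u v)"
      then obtain E x y where "p = (E, x, y)" "E \<in> ?A" "(x, y) \<in> fwd H u v E" by (cases p) auto
      with ff[of E x y] show "?g (?f p) = p" by simp
    qed
    show "\<forall>p\<in>Sigma ?B (bwd H u v). ?f (?g p) = p"
    proof
      fix p assume "p \<in> Sigma ?B (bwd H u v)"
      then obtain E x y where "p = (E, x, y)" "E \<in> ?B" "(x, y) \<in> bwd H u v E" by (cases p) auto
      with gg[of E x y] show "?f (?g p) = p" by simp
    qed
    show "?f ` Sigma ?A (fwd H u v) \<subseteq> Sigma ?B (bwd H u v)"
    proof (rule image_subsetI)
      fix p assume "p \<in> Sigma ?A (fwd H u v)"
      then obtain E x y where "p = (E, x, y)" "E \<in> ?A" "(x, y) \<in> fwd H u v E" by (cases p) auto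
      with ff[of E x y] show "?f p \<in> Sigma ?B (bwd H u v)" by simp
    qed
    show "?g ` Sigma ?B (bwd H u v) \<subseteq> Sigma ?A (fwd H u v)"
    proof (rule image_subsetI)
      fix p assume "p \<in> Sigma ?B (bwd H u v)"
      then obtain E x y where "p = (E, x, y)" "E \<in> ?B" "(x, y) \<in> bwd H u v E" by (cases p) auto
      with gg[of E x y] show "?g p \<in> Sigma ?A (fwd H u v)" by simp
    qed
  qed
  then have "card (Sigma ?A (fwd H u v)) = card (Sigma ?B (bwd H u v))"
    by (rule bij_betw_same_card)
  moreover have "card (Sigma ?A (fwd H u v)) = (\<Sum>E\<in>?A. card (fwd H u v E))"
    using fin V by (intro card_SigmaI) (auto simp: containing_def intro: finite_fwd)
  moreover have "card (Sigma ?B (bwd H u v)) = (\<Sum>E\<in>?B. card (bwd H u v E))"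
    using fin V by (intro card_SigmaI) (auto simp: containing_def intro: finite_bwd)
  ultimately show ?thesis by simp
qed

text \<open>Merging a leaf \<open>b\<close> into a vertex \<open>a\<close> is reversed by choosing one of the edges at \<open>a\<close>.\<close>

lemma merge_leaf_count:
  assumes V: "finite V" "a \<in> V" "b \<in> V" "a \<noteq> b" and d: "d b = 1"
  shows "(d a + 1) * card (graphs V (d(a := d a + 1, b := 0))) =
    (\<Sum>x\<in>V - {a, b}. card {E \<in> containing V d {{b, x}}. {x, a} \<notin> E})"
proof -
  let ?d = "d(a := d a + 1, b := 0)"
  let ?A = "graphs V ?d"
  let ?B = "\<lambda>x. {E \<in> containing V d {{b, x}}. {x, a} \<notin> E}"
  let ?f = "\<lambda>(E, x). (x, (E - {{a, x}}) \<union> {{b, x}})"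
  let ?g = "\<lambda>(x, E). ((E - {{b, x}}) \<union> {{a, x}}, x)"
  have ff: "(E - {{a, x}}) \<union> {{b, x}} \<in> ?B x \<and> x \<in> V - {a, b} \<and>
      (E - {{a, x}}) \<union> {{b, x}} - {{b, x}} \<union> {{a, x}} = E"
    if E: "E \<in> ?A" and x: "x \<in> nbrs E a" for E x
  proof -
    have ax: "{a, x} \<in> E" using x by (simp add: nbrs_def)
    have xV: "x \<in> V" "x \<noteq> a" using graphs_edgeD[OF E ax] by auto
    have nb: "nbrs E b = {}"
      using card_nbrs[OF E V(3)] finite_subset[OF nbrs_subset[OF E] V(1)] by simp
    have bx: "{b, x} \<notin> E" using nb by (auto simp: nbrs_def)
    have xb: "x \<noteq> b" using nb ax by (auto simp: nbrs_def insert_commute)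
    have "(E - {{a, x}}) \<union> {{b, x}} \<in> graphs V d"
    proof (rule graphs_exchange[OF V(1) E])
      fix i assume "i \<in> V"
      show "d i + deg {{a, x}} i = ?d i + deg {{b, x}} i"
        using V d xV xb by (auto simp: deg_one)
    qed (use ax bx xV xb V in auto)
    then show ?thesis using ax bx xV xb V
      by (auto simp: containing_def doubleton_eq_iff)
  qed
  have gg: "(E - {{b, x}}) \<union> {{a, x}} \<in> ?A \<and> x \<in> nbrs ((E - {{b, x}}) \<union> {{a, x}}) a \<and>
      (E - {{b, x}}) \<union> {{a, x}} - {{a, x}} \<union> {{b, x}} = E"
    if x: "x \<in> V - {a, b}" and E: "E \<in> ?B x" for E x
  proof -
    have E': "E \<in> graphs V d" "{b, x} \<in> E" "{a, x} \<notin> E"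
      using E by (auto simp: containing_def insert_commute)
    have "(E - {{b, x}}) \<union> {{a, x}} \<in> ?A"
    proof (rule graphs_exchange[OF V(1) E'(1)])
      fix i assume "i \<in> V"
      show "?d i + deg {{b, x}} i = d i + deg {{a, x}} i"
        using V d x by (auto simp: deg_one)
    qed (use E' x V in auto)
    then show ?thesis using E' by (auto simp: nbrs_def)
  qed
  have "bij_betw ?f (Sigma ?A (\<lambda>E. nbrs E a)) (Sigma (V - {a, b}) ?B)"
  proof (rule bij_betw_byWitness[where f' = ?g])
    show "\<forall>p\<in>Sigma ?A (\<lambda>E. nbrs E a). ?g (?f p) = p"
    proof
      fix p assume "p \<in> Sigma ?A (\<lambda>E. nbrs E a)"
      then obtain E x where "p = (E, x)" "E \<in> ?A" "x \<in> nbrs E a" by blast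
      with ff[of E x] show "?g (?f p) = p" by simp
    qed
    show "\<forall>p\<in>Sigma (V - {a, b}) ?B. ?f (?g p) = p"
    proof
      fix p assume "p \<in> Sigma (V - {a, b}) ?B"
      then obtain E x where "p = (x, E)" "x \<in> V - {a, b}" "E \<in> ?B x" by blast
      with gg[of x E] show "?f (?g p) = p" by simp
    qed
    show "?f ` Sigma ?A (\<lambda>E. nbrs E a) \<subseteq> Sigma (V - {a, b}) ?B"
    proof (rule image_subsetI)
      fix p assume "p \<in> Sigma ?A (\<lambda>E. nbrs E a)"
      then obtain E x where "p = (E, x)" "E \<in> ?A" "x \<in> nbrs E a" by blast
      with ff[of E x] show "?f p \<in> Sigma (V - {a, b}) ?B" by simp
    qed
    show "?g ` Sigma (V - {a, b}) ?B \<subseteq> Sigma ?A (\<lambda>E. nbrs E a)"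
    proof (rule image_subsetI)
      fix p assume "p \<in> Sigma (V - {a, b}) ?B"
      then obtain E x where "p = (x, E)" "x \<in> V - {a, b}" "E \<in> ?B x" by blast
      with gg[of x E] show "?g p \<in> Sigma ?A (\<lambda>E. nbrs E a)" by simp
    qed
  qed
  then have "card (Sigma ?A (\<lambda>E. nbrs E a)) = card (Sigma (V - {a, b}) ?B)"
    by (rule bij_betw_same_card)
  moreover have "card (Sigma ?A (\<lambda>E. nbrs E a)) = (\<Sum>E\<in>?A. d a + 1)"
    using V finite_graphs[OF V(1)]
    by (subst card_SigmaI) (auto simp: card_nbrs intro: finite_subset[OF nbrs_subset])
  moreover have "card (Sigma (V - {a, b}) ?B) = (\<Sum>x\<in>V - {a, b}. card (?B x))"
    using V finite_graphs[OF V(1)] by (subst card_SigmaI) (auto simp: containing_def)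
  ultimately show ?thesis by (simp add: mult.commute)
qed

section \<open>Edge probabilities\<close>

lemma sum_card_swap:
  assumes "finite G" "finite P"
  shows "(\<Sum>E\<in>G. real (card {p \<in> P. Q E p})) = (\<Sum>p\<in>P. real (card {E \<in> G. Q E p}))"
proof -
  have "(\<Sum>E\<in>G. real (card {p \<in> P. Q E p})) = (\<Sum>E\<in>G. \<Sum>p\<in>P. of_bool (Q E p))"
    using assms by (simp add: Collect_conj_eq Int_commute)
  also have "\<dots> = (\<Sum>p\<in>P. \<Sum>E\<in>G. of_bool (Q E p))" by (rule sum.swap)
  also have "\<dots> = (\<Sum>p\<in>P. real (card {E \<in> G. Q E p}))"
    using assms by (simp add: Collect_conj_eq Int_commute)
  finally show ?thesis .
qed

lemma card_arcs_le:
  assumes "finite H"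
  shows "finite {(x, y). {x, y} \<in> H}" "card {(x, y). {x, y} \<in> H} \<le> 2 * card H"
proof -
  have one: "finite {(x, y). {x, y} = e} \<and> card {(x, y). {x, y} = e} \<le> 2" for e :: "'a set"
  proof (cases "\<exists>i j. e = {i, j}")
    case True
    then obtain i j where "e = {i, j}" by blast
    then have *: "{(x, y). {x, y} = e} \<subseteq> {(i, j), (j, i)}" by (auto simp: doubleton_eq_iff)
    have fin: "finite {(i, j), (j, i)}" by simp
    have "card {(x, y). {x, y} = e} \<le> card {(i, j), (j, i)}" by (rule card_mono[OF fin *])
    also have "\<dots> \<le> 2" using card_insert_le_m1[of 2 "{(j, i)}" "(i, j)"] by simp
    finally show ?thesis using finite_subset[OF * fin] by simp
  next
    case False
    then have "{(x, y). {x, y} = e} = {}" by auto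
    then show ?thesis by simp
  qed
  have eq: "{(x, y). {x, y} \<in> H} = (\<Union>e\<in>H. {(x, y). {x, y} = e})" by auto
  show "finite {(x, y). {x, y} \<in> H}" unfolding eq using assms one by blast
  have "card {(x, y). {x, y} \<in> H} \<le> (\<Sum>e\<in>H. card {(x, y). {x, y} = e})"
    unfolding eq by (rule card_UN_le[OF assms])
  also have "\<dots> \<le> (\<Sum>e\<in>H. 2)" by (rule sum_mono) (use one in auto)
  finally show "card {(x, y). {x, y} \<in> H} \<le> 2 * card H" by simp
qed

lemma card_nbrs_le: "finite H \<Longrightarrow> finite (nbrs H u) \<and> card (nbrs H u) \<le> card H"
proof -
  assume H: "finite H"
  have inj: "inj_on (\<lambda>v. {u, v}) (nbrs H u)" by (auto simp: inj_on_def doubleton_eq_iff)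
  have im: "(\<lambda>v. {u, v}) ` nbrs H u \<subseteq> H" by (auto simp: nbrs_def)
  show ?thesis
    using card_mono[OF H im] card_image[OF inj] finite_subset[OF im H] finite_imageD[OF _ inj] by auto
qed

text \<open>The sum of squares is bounded by an inequality, so the same \<open>D\<close> serves
  every sequence between the matching and the target. The factor 400 makes D^(3/2), the worst-case
  number of two-paths from a vertex, at most N/20; together with N \<le> D^2 it forces N \<ge>
  400^2.\<close>

locale sparse_degrees =
  fixes V :: "'a set" and d :: "'a \<Rightarrow> nat" and N D :: real
  assumes finite_V: "finite V"
    and sum_d: "(\<Sum>i\<in>V. real (d i)) = N"
    and sum_d_sq: "(\<Sum>i\<in>V. (real (d i))\<^sup>2) \<le> D\<^sup>2"
    and N_pos: "0 < N" and D_nonneg: "0 \<le> D"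
    and small: "400 * D ^ 3 \<le> N\<^sup>2"
begin

text \<open>For \<open>H \<subseteq> H'\<close> the ratio of \<open>c H'\<close> to
  \<open>c H\<close> is the probability that a uniform random graph containing \<open>H\<close>
  contains \<open>H'\<close>. Working with counts keeps the inequalities meaningful when no graph
  contains \<open>H\<close>.\<close>

definition c :: "'a set set \<Rightarrow> real" where
  "c H = real (card (containing V d H))"

lemma finite_containing [simp]: "finite (containing V d H)"
  using finite_graphs[OF finite_V] by (simp add: containing_def)

lemma c_nonneg [simp]: "0 \<le> c H"
  by (simp add: c_def)

lemma c_mono: "H \<subseteq> H' \<Longrightarrow> c H' \<le> c H"
  unfolding c_def by (intro of_nat_mono card_mono finite_containing) (auto simp: containing_def)

lemma d_le_D:
  assumes "u \<in> V"
  shows "real (d u) \<le> D"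
proof -
  have "(real (d u))\<^sup>2 \<le> (\<Sum>i\<in>V. (real (d i))\<^sup>2)"
    using assms finite_V by (intro member_le_sum) auto
  also note sum_d_sq
  finally show ?thesis by (rule power2_le_imp_le[OF _ D_nonneg])
qed

lemma d_sq_ge: "real (d i) \<le> (real (d i))\<^sup>2"
proof -
  have "d i \<le> d i * d i" by (rule le_square)
  then show ?thesis by (simp add: power2_eq_square flip: of_nat_mult)
qed

lemma N_le_D2: "N \<le> D\<^sup>2"
proof -
  have "N \<le> (\<Sum>i\<in>V. (real (d i))\<^sup>2)"
    unfolding sum_d[symmetric] by (intro sum_mono d_sq_ge)
  with sum_d_sq show ?thesis by linarith
qed

lemma N_ge_1: "1 \<le> N"
proof -
  have "N = real (\<Sum>i\<in>V. d i)" using sum_d by simp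
  with N_pos show ?thesis by (metis of_nat_0_less_iff of_nat_1 of_nat_mono Suc_leI One_nat_def)
qed

lemma D_ge_1: "1 \<le> D"
proof (rule ccontr)
  assume "\<not> 1 \<le> D"
  then have "D\<^sup>2 < 1" using D_nonneg by (simp add: power_less_one_iff)
  with N_le_D2 N_ge_1 show False by linarith
qed

lemma N_large: "160000 \<le> N"
proof -
  have "N ^ 3 \<le> (D\<^sup>2) ^ 3" using N_le_D2 N_pos by (intro power_mono) auto
  also have "\<dots> = (D ^ 3)\<^sup>2" by (simp add: power_mult[symmetric])
  also have "\<dots> \<le> (N\<^sup>2 / 400)\<^sup>2" using small D_nonneg by (intro power_mono) auto
  also have "\<dots> = N ^ 3 * (N / 160000)" by (simp add: power2_eq_square power3_eq_cube)
  finally have "N ^ 3 * 1 \<le> N ^ 3 * (N / 160000)" by simp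
  then have "1 \<le> N / 160000" using N_pos by (subst (asm) mult_le_cancel_left_pos) auto
  then show ?thesis by simp
qed

lemma D_le: "D \<le> N / 20"
proof -
  have "D\<^sup>2 \<le> D ^ 3" using D_ge_1 by (intro power_increasing) auto
  also have "\<dots> \<le> (N / 20)\<^sup>2" using small by (simp add: power_divide)
  finally show ?thesis by (rule power2_le_imp_le) (use N_pos in simp)
qed

text \<open>Cauchy-Schwarz over the at most D neighbours bounds the sum by the square root of D^2 *
  D, and \<open>small\<close> makes this at most N/20.\<close>

lemma sum_nbrs_le:
  assumes "E \<in> graphs V d" "u \<in> V"
  shows "(\<Sum>x\<in>nbrs E u. real (d x)) \<le> N / 20"
proof -
  have sub: "nbrs E u \<subseteq> V" by (rule nbrs_subset[OF assms(1)])
  have "(\<Sum>x\<in>nbrs E u. real (d x))\<^sup>2 \<le> (\<Sum>x\<in>nbrs E u. (real (d x))\<^sup>2) * real (card (nbrs E u))"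
    by (rule sum_squared_le_sum_of_squares)
  also have "\<dots> \<le> D\<^sup>2 * D"
  proof (intro mult_mono)
    have "(\<Sum>x\<in>nbrs E u. (real (d x))\<^sup>2) \<le> (\<Sum>x\<in>V. (real (d x))\<^sup>2)"
      using finite_V sub by (intro sum_mono2) auto
    with sum_d_sq show "(\<Sum>x\<in>nbrs E u. (real (d x))\<^sup>2) \<le> D\<^sup>2" by linarith
  qed (use card_nbrs[OF assms] d_le_D[OF assms(2)] D_nonneg in auto)
  also have "D\<^sup>2 * D = D ^ 3" by (simp add: power2_eq_square power3_eq_cube)
  also have "D ^ 3 \<le> (N / 20)\<^sup>2" using small by (simp add: power_divide)
  finally show ?thesis by (rule power2_le_imp_le) (use N_pos in simp)
qed

definition arcs :: "'a set set \<Rightarrow> ('a \<times> 'a) set" where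
  "arcs E = {(x, y). {x, y} \<in> E}"

lemma arcs_eq: "E \<in> graphs V d \<Longrightarrow> arcs E = Sigma V (nbrs E)"
  unfolding arcs_def nbrs_def by (auto dest: graphs_edgeD)

lemma finite_nbrs: "E \<in> graphs V d \<Longrightarrow> finite (nbrs E u)"
  by (rule finite_subset[OF nbrs_subset finite_V])

lemma card_arcs: "E \<in> graphs V d \<Longrightarrow> finite (arcs E) \<and> real (card (arcs E)) = N"
proof -
  assume E: "E \<in> graphs V d"
  have "card (arcs E) = (\<Sum>x\<in>V. card (nbrs E x))"
    unfolding arcs_eq[OF E] using finite_V finite_nbrs[OF E] by (intro card_SigmaI) auto
  also have "\<dots> = (\<Sum>x\<in>V. d x)" by (intro sum.cong card_nbrs[OF E] refl)
  finally have "real (card (arcs E)) = N" using sum_d by simp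
  moreover have "finite (arcs E)"
    unfolding arcs_eq[OF E] using finite_V finite_nbrs[OF E] by auto
  ultimately show ?thesis by blast
qed

lemma card_fwd_le: "E \<in> graphs V d \<Longrightarrow> real (card (fwd H u v E)) \<le> N"
proof -
  assume E: "E \<in> graphs V d"
  have "fwd H u v E \<subseteq> arcs E" by (auto simp: fwd_def arcs_def)
  with card_arcs[OF E] card_mono[of "arcs E" "fwd H u v E"] show ?thesis by linarith
qed

text \<open>Of the N oriented edges five kinds are excluded: those in \<open>H\<close>, leaving
  \<open>u\<close>, entering \<open>v\<close>, leaving a neighbour of \<open>u\<close>, entering a
  neighbour of \<open>v\<close>. The cases \<open>x = v\<close> and \<open>y = u\<close> fall under
  the last two because \<open>uv\<close> is an edge.\<close>

lemma card_fwd_ge: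
  assumes E: "E \<in> graphs V d" and uv: "{u, v} \<in> E" and H: "finite H"
  shows "N - (2 * real (card H) + real (d u) + real (d v)
      + (\<Sum>x\<in>nbrs E u. real (d x)) + (\<Sum>y\<in>nbrs E v. real (d y))) \<le> real (card (fwd H u v E))"
proof -
  have V: "u \<in> V" "v \<in> V" using graphs_edgeD[OF E uv] by auto
  define B1 where "B1 = {(x, y). {x, y} \<in> H}"
  define B2 where "B2 = {u} \<times> nbrs E u"
  define B3 where "B3 = (\<lambda>x. (x, v)) ` nbrs E v"
  define B4 where "B4 = Sigma (nbrs E u) (nbrs E)"
  define B5 where "B5 = (\<lambda>(y, x). (x, y)) ` Sigma (nbrs E v) (nbrs E)"
  note B = B1_def B2_def B3_def B4_def B5_def
  have fin: "finite B1" "finite B2" "finite B3" "finite B4" "finite B5" "finite (fwd H u v E)"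
    using card_arcs_le[OF H] finite_nbrs[OF E] finite_fwd[OF finite_V E] by (auto simp: B)
  have inV: "x \<in> V" if "x \<in> nbrs E w" for x w using nbrs_subset[OF E] that by blast
  have "arcs E \<subseteq> fwd H u v E \<union> (B1 \<union> (B2 \<union> (B3 \<union> (B4 \<union> B5))))"
    using uv by (auto simp: arcs_def fwd_def B nbrs_def image_iff insert_commute)
  then have "card (arcs E) \<le> card (fwd H u v E \<union> (B1 \<union> (B2 \<union> (B3 \<union> (B4 \<union> B5)))))"
    using fin by (intro card_mono) auto
  also have "\<dots> \<le> card (fwd H u v E) + (card B1 + (card B2 + (card B3 + (card B4 + card B5))))"
    by (intro order_trans[OF card_Un_le] add_mono order.refl)
  finally have 1: "N \<le> real (card (fwd H u v E)) + (real (card B1) + (real (card B2) +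
      (real (card B3) + (real (card B4) + real (card B5)))))"
    using card_arcs[OF E] by linarith
  have b1: "real (card B1) \<le> 2 * real (card H)"
    using card_arcs_le[OF H] by (simp add: B1_def)
  have b2: "card B2 = d u" using card_nbrs[OF E V(1)] by (simp add: B2_def card_cartesian_product)
  have b3: "card B3 \<le> d v" using card_nbrs[OF E V(2)] card_image_le[OF finite_nbrs[OF E]]
    by (metis B3_def)
  have S: "card (Sigma (nbrs E w) (nbrs E)) = (\<Sum>x\<in>nbrs E w. d x)" for w
    using finite_nbrs[OF E] card_nbrs[OF E] inV by (subst card_SigmaI) (auto intro!: sum.cong)
  have b4: "card B4 = (\<Sum>x\<in>nbrs E u. d x)" by (simp add: B4_def S)
  have b5: "card B5 \<le> (\<Sum>x\<in>nbrs E v. d x)"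
    using card_image_le[of "Sigma (nbrs E v) (nbrs E)" "\<lambda>(y, x). (x, y)"] finite_nbrs[OF E]
    unfolding B5_def S[symmetric] by auto
  have b5': "real (card B5) \<le> (\<Sum>x\<in>nbrs E v. real (d x))" using b5
    by (metis of_nat_mono of_nat_sum)
  have b4': "real (card B4) = (\<Sum>x\<in>nbrs E u. real (d x))" using b4 by simp
  from 1 b1 b2 b3 b4' b5' show ?thesis by linarith
qed

text \<open>In a graph containing \<open>H\<close> this is the number of edges at \<open>u\<close>
  outside \<open>H\<close>, the only ones a switching may remove. If \<open>H\<close> consists of
  \<open>bx\<close> alone, its value at \<open>x\<close> is d_x - 1, the source of that factor in
  the path probabilities.\<close>

definition free_deg :: "'a set set \<Rightarrow> 'a \<Rightarrow> real" where
  "free_deg H u = real (d u) - real (card (nbrs H u))"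

lemma card_nbrs_diff:
  assumes "E \<in> graphs V d" "H \<subseteq> E" "finite H" "w \<in> V"
  shows "real (card (nbrs E w - nbrs H w)) = free_deg H w"
proof -
  have "nbrs H w \<subseteq> nbrs E w" using assms by (auto simp: nbrs_def)
  then have "card (nbrs H w) \<le> d w" "card (nbrs E w - nbrs H w) = d w - card (nbrs H w)"
    using card_nbrs[OF assms(1,4)] card_nbrs_le[OF assms(3)] finite_nbrs[OF assms(1)]
      card_mono[of "nbrs E w" "nbrs H w"]
    by (auto simp: card_Diff_subset)
  then show ?thesis by (simp add: of_nat_diff free_deg_def)
qed

lemma card_bwd_le:
  assumes "E \<in> graphs V d" "H \<subseteq> E" "u \<in> V" "v \<in> V" "finite H"
  shows "real (card (bwd H u v E)) \<le> free_deg H u * free_deg H v"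
proof -
  have "card (bwd H u v E) \<le> card ((nbrs E u - nbrs H u) \<times> (nbrs E v - nbrs H v))"
    using finite_nbrs[OF assms(1)] by (intro card_mono) (auto simp: bwd_def nbrs_def)
  also have "real \<dots> = free_deg H u * free_deg H v"
    using assms by (simp add: card_cartesian_product card_nbrs_diff)
  finally show ?thesis by simp
qed

section \<open>Edge probabilities up to a constant factor\<close>

lemma c_diff: "real (card (containing V d H - containing V d (insert e H))) = c H - c (insert e H)"
proof -
  have "containing V d (insert e H) \<subseteq> containing V d H" by (auto simp: containing_def)
  then show ?thesis by (simp add: c_def card_Diff_subset of_nat_diff card_mono)
qed

text \<open>Worst-case counting: at least N/2 forward switchings from a graph with
  \<open>uv\<close>, at most d_u d_v backward ones from a graph without. \<open>H\<close> may have
  three edges because a blocked backward switching adds \<open>ux\<close>, \<open>vy\<close> and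
  \<open>xy\<close> to at most one given edge, and three are present when the last is added.\<close>

lemma edge_odds_le:
  assumes "u \<in> V" "v \<in> V" "u \<noteq> v" "{u, v} \<notin> H" "finite H" "card H \<le> 3"
  shows "c (insert {u, v} H) * (N / 2) \<le> real (d u) * real (d v) * (c H - c (insert {u, v} H))"
proof -
  let ?A = "containing V d (insert {u, v} H)"
  let ?B = "containing V d H - containing V d (insert {u, v} H)"
  \<comment> \<open>Excluded are at most 6 oriented edges for \<open>H\<close>, 2 D for the two
    degrees and 2 N/20 for the neighbourhoods; with D \<le> N/20 this is below N/2.\<close>
  have f: "N / 2 \<le> real (card (fwd H u v E))" if "E \<in> ?A" for E
  proof -
    have E: "E \<in> graphs V d" "{u, v} \<in> E" using that by (auto simp: containing_def)
    show ?thesis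
      using card_fwd_ge[OF E \<open>finite H\<close>] sum_nbrs_le[OF E(1) assms(1)] sum_nbrs_le[OF E(1) assms(2)]
        of_nat_mono[OF assms(6), where 'a = real] d_le_D[OF assms(1)] d_le_D[OF assms(2)] D_le N_large
      by simp
  qed
  have b: "real (card (bwd H u v E)) \<le> real (d u) * real (d v)" if "E \<in> ?B" for E
  proof -
    have E: "E \<in> graphs V d" "H \<subseteq> E" using that by (auto simp: containing_def)
    have "card (bwd H u v E) \<le> card (nbrs E u \<times> nbrs E v)"
      using finite_nbrs[OF E(1)] by (intro card_mono) (auto simp: bwd_def nbrs_def)
    then show ?thesis using card_nbrs[OF E(1)] assms(1,2)
      by (simp add: card_cartesian_product flip: of_nat_mult)
  qed
  have "c (insert {u, v} H) * (N / 2) = (\<Sum>E\<in>?A. N / 2)" by (simp add: c_def)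
  also have "\<dots> \<le> (\<Sum>E\<in>?A. real (card (fwd H u v E)))" by (intro sum_mono f)
  also have "\<dots> = (\<Sum>E\<in>?B. real (card (bwd H u v E)))"
    using switching_count[OF finite_V assms(1-4), of d] by (metis of_nat_sum)
  also have "\<dots> \<le> (\<Sum>E\<in>?B. real (d u) * real (d v))" by (intro sum_mono b)
  also have "\<dots> = real (d u) * real (d v) * (c H - c (insert {u, v} H))" by (simp add: c_diff)
  finally show ?thesis .
qed

text \<open>Formulated for iteration: the indicator covers an edge that is already required, and a
  loop \<open>u = v\<close> lies in no graph.\<close>

lemma c_insert_le:
  assumes "u \<in> V" "v \<in> V" "finite H" "card H \<le> 3"
  shows "c (insert {u, v} H) \<le> (2 * real (d u) * real (d v) / N + of_bool ({u, v} \<in> H)) * c H"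
proof (cases "{u, v} \<in> H")
  case True
  then have "c (insert {u, v} H) = 1 * c H" by (simp add: insert_absorb)
  also have "\<dots> \<le> (2 * real (d u) * real (d v) / N + of_bool ({u, v} \<in> H)) * c H"
    using True N_pos by (intro mult_right_mono) auto
  finally show ?thesis .
next
  case F: False
  show ?thesis
  proof (cases "u = v")
    case True
    then have "containing V d (insert {u, v} H) = {}"
      by (auto simp: containing_def dest: graphs_edgeD[of _ _ _ u u])
    then show ?thesis using N_pos by (simp add: c_def)
  next
    case False
    have "c (insert {u, v} H) * (N / 2) \<le> real (d u) * real (d v) * (c H - c (insert {u, v} H))"
      by (rule edge_odds_le) (use assms F False in auto)
    also have "\<dots> \<le> real (d u) * real (d v) * c H" by (intro mult_left_mono) auto
    finally show ?thesis using F N_pos by (simp add: field_simps)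
  qed
qed

text \<open>Averaging beats the worst case. By the crude bound a vertex x contributes at most 2 d_u
  d_x^2 / N, in total 2 D^3 / N, and the at most two neighbours forced by \<open>H\<close> add at
  most D each.\<close>

lemma sum_nbrs_expectation:
  assumes "u \<in> V" "finite H" "card H \<le> 2"
  shows "(\<Sum>E\<in>containing V d H. \<Sum>x\<in>nbrs E u. real (d x)) \<le> (2 * D ^ 3 / N + 2 * D) * c H"
proof -
  have fin: "finite (nbrs H u)" "card (nbrs H u) \<le> 2" using card_nbrs_le[OF assms(2), of u] assms by auto
  have "(\<Sum>E\<in>containing V d H. \<Sum>x\<in>nbrs E u. real (d x)) =
      (\<Sum>E\<in>containing V d H. \<Sum>x\<in>V. of_bool ({u, x} \<in> E) * real (d x))"
  proof (rule sum.cong)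
    fix E assume "E \<in> containing V d H"
    then have E: "nbrs E u = {x \<in> V. {u, x} \<in> E}"
      by (auto simp: containing_def nbrs_def dest: graphs_edgeD)
    have "(\<Sum>x\<in>nbrs E u. real (d x)) = (\<Sum>x\<in>V. if {u, x} \<in> E then real (d x) else 0)"
      unfolding E using finite_V by (intro sum.inter_filter) auto
    also have "\<dots> = (\<Sum>x\<in>V. of_bool ({u, x} \<in> E) * real (d x))"
      by (intro sum.cong) auto
    finally show "(\<Sum>x\<in>nbrs E u. real (d x)) = (\<Sum>x\<in>V. of_bool ({u, x} \<in> E) * real (d x))" .
  qed simp
  also have "\<dots> = (\<Sum>x\<in>V. \<Sum>E\<in>containing V d H. of_bool ({u, x} \<in> E) * real (d x))"
    by (rule sum.swap)
  also have "\<dots> = (\<Sum>x\<in>V. c (insert {u, x} H) * real (d x))"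
  proof (intro sum.cong refl)
    fix x
    have "containing V d (insert {u, x} H) = containing V d H \<inter> {E. {u, x} \<in> E}"
      by (auto simp: containing_def)
    then show "(\<Sum>E\<in>containing V d H. of_bool ({u, x} \<in> E) * real (d x)) = c (insert {u, x} H) * real (d x)"
      by (simp add: c_def flip: sum_distrib_right)
  qed
  also have "\<dots> \<le> (\<Sum>x\<in>V. ((2 * real (d u) * real (d x) / N + of_bool ({u, x} \<in> H)) * c H) * real (d x))"
    using assms by (intro sum_mono mult_right_mono c_insert_le) auto
  also have "\<dots> \<le> (\<Sum>x\<in>V. (2 * D / N * (real (d x))\<^sup>2) * c H + (of_bool ({u, x} \<in> H) * D) * c H)"
  proof (intro sum_mono)
    fix x assume x: "x \<in> V"
    have "2 * real (d u) * real (d x) / N * real (d x) \<le> 2 * D / N * (real (d x))\<^sup>2"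
      using d_le_D[OF assms(1)] N_pos by (auto simp: power2_eq_square divide_simps intro!: mult_right_mono)
    moreover have "of_bool ({u, x} \<in> H) * real (d x) \<le> of_bool ({u, x} \<in> H) * D"
      using d_le_D[OF x] by auto
    ultimately have "(2 * real (d u) * real (d x) / N * real (d x) + of_bool ({u, x} \<in> H) * real (d x)) * c H \<le>
      (2 * D / N * (real (d x))\<^sup>2 + of_bool ({u, x} \<in> H) * D) * c H"
      by (intro mult_right_mono add_mono) auto
    then show "((2 * real (d u) * real (d x) / N + of_bool ({u, x} \<in> H)) * c H) * real (d x) \<le>
      (2 * D / N * (real (d x))\<^sup>2) * c H + (of_bool ({u, x} \<in> H) * D) * c H"
      by (simp add: algebra_simps)
  qed
  also have "\<dots> = (2 * D / N * (\<Sum>x\<in>V. (real (d x))\<^sup>2) + (\<Sum>x\<in>V. of_bool ({u, x} \<in> H)) * D) * c H"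
    by (simp add: sum.distrib sum_distrib_left sum_distrib_right algebra_simps)
  also have "\<dots> \<le> (2 * D / N * D\<^sup>2 + 2 * D) * c H"
  proof (intro mult_right_mono add_mono mult_left_mono)
    have "(\<Sum>x\<in>V. of_bool ({u, x} \<in> H) :: real) = real (card (V \<inter> {x. {u, x} \<in> H}))"
      using finite_V by simp
    also have "\<dots> \<le> real (card (nbrs H u))"
      using fin by (intro of_nat_mono card_mono) (auto simp: nbrs_def)
    finally show "(\<Sum>x\<in>V. of_bool ({u, x} \<in> H) :: real) \<le> 2" using fin by linarith
  qed (use D_nonneg N_pos sum_d_sq in auto)
  finally show ?thesis by (simp add: power2_eq_square power3_eq_cube algebra_simps)
qed

section \<open>Edge probabilities with relative error of order D^3/N^2\<close>

definition eps :: real where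
  "eps = D ^ 3 / N\<^sup>2"

lemma eps_bounds: "0 \<le> eps" "eps \<le> 1 / 400"
  using small N_pos D_nonneg by (auto simp: eps_def field_simps)

text \<open>The averaged forward count. On average a vertex starts only O(D^3/N) two-paths, so the
  share of the N oriented edges that is lost is 12 \<open>eps\<close>.\<close>

lemma sum_fwd_ge:
  assumes "u \<in> V" "v \<in> V" "finite H" "card H \<le> 1"
  shows "c (insert {u, v} H) * (N - 12 * D ^ 3 / N) \<le>
    (\<Sum>E\<in>containing V d (insert {u, v} H). real (card (fwd H u v E)))"
proof -
  let ?H = "insert {u, v} H"
  let ?A = "containing V d ?H"
  have cH: "finite ?H" "card ?H \<le> 2" using assms by (auto simp: card_insert_if)
  have "D * N \<le> D * D\<^sup>2" using N_le_D2 D_nonneg by (intro mult_left_mono)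
  then have DN: "D \<le> D ^ 3 / N" using N_pos by (simp add: field_simps power2_eq_square power3_eq_cube)
  \<comment> \<open>12 = 2 + 2 + 4 + 4, for \<open>H\<close>, the two degrees, and the two parts of
    both neighbourhood sums; the number 1 and D are both at most D^3/N.\<close>
  have bad: "c ?H * (2 + 2 * D) + 2 * ((2 * D ^ 3 / N + 2 * D) * c ?H) \<le> c ?H * (12 * D ^ 3 / N)"
  proof -
    have "c ?H * (2 + 2 * D + 2 * (2 * D ^ 3 / N + 2 * D)) \<le> c ?H * (12 * D ^ 3 / N)"
      using DN D_ge_1 by (intro mult_left_mono) auto
    then show ?thesis by (simp add: algebra_simps)
  qed
  have f: "N - (2 + 2 * D) - (\<Sum>x\<in>nbrs E u. real (d x)) - (\<Sum>x\<in>nbrs E v. real (d x))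
      \<le> real (card (fwd H u v E))" if "E \<in> ?A" for E
  proof -
    have E: "E \<in> graphs V d" "{u, v} \<in> E" using that by (auto simp: containing_def)
    show ?thesis
      using card_fwd_ge[OF E assms(3)] d_le_D[OF assms(1)] d_le_D[OF assms(2)]
        of_nat_mono[OF assms(4), where 'a = real] by simp
  qed
  have "(\<Sum>E\<in>?A. N - (2 + 2 * D) - (\<Sum>x\<in>nbrs E u. real (d x)) - (\<Sum>x\<in>nbrs E v. real (d x)))
      \<le> (\<Sum>E\<in>?A. real (card (fwd H u v E)))"
    by (intro sum_mono f)
  moreover have "(\<Sum>E\<in>?A. N - (2 + 2 * D) - (\<Sum>x\<in>nbrs E u. real (d x)) - (\<Sum>x\<in>nbrs E v. real (d x)))
     = c ?H * (N - (2 + 2 * D)) - (\<Sum>E\<in>?A. \<Sum>x\<in>nbrs E u. real (d x)) - (\<Sum>E\<in>?A. \<Sum>x\<in>nbrs E v. real (d x))"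
    by (simp add: sum_subtractf c_def)
  moreover have "c ?H * (N - 12 * D ^ 3 / N) = c ?H * N - c ?H * (12 * D ^ 3 / N)"
    "c ?H * (N - (2 + 2 * D)) = c ?H * N - c ?H * (2 + 2 * D)"
    by (simp_all add: algebra_simps)
  ultimately show ?thesis
    using bad sum_nbrs_expectation[OF assms(1) cH] sum_nbrs_expectation[OF assms(2) cH] by linarith
qed

text \<open>The choices of removable edges \<open>ux\<close>, \<open>vy\<close> that
  \<open>bwd\<close> rejects: the switching would create a loop or double the edge
  \<open>xy\<close>.\<close>

definition blocked :: "'a set set \<Rightarrow> 'a \<Rightarrow> 'a \<Rightarrow> 'a set set \<Rightarrow> 'a \<times> 'a \<Rightarrow> bool" where
  "blocked H u v E = (\<lambda>(x, y). {u, x} \<in> E - H \<and> {v, y} \<in> E - H \<and> (x = y \<or> {x, y} \<in> E))"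

lemma card_bwd_ge:
  assumes "E \<in> graphs V d" "H \<subseteq> E" "u \<in> V" "v \<in> V" "finite H"
  shows "free_deg H u * free_deg H v \<le>
    real (card (bwd H u v E)) + real (card {p \<in> V \<times> V. blocked H u v E p})"
proof -
  have sub: "(nbrs E u - nbrs H u) \<times> (nbrs E v - nbrs H v) \<subseteq>
      bwd H u v E \<union> {p \<in> V \<times> V. blocked H u v E p}"
    using nbrs_subset[OF assms(1)] by (auto simp: bwd_def blocked_def nbrs_def dest: subsetD)
  have "card ((nbrs E u - nbrs H u) \<times> (nbrs E v - nbrs H v)) \<le>
      card (bwd H u v E \<union> {p \<in> V \<times> V. blocked H u v E p})"
    using finite_V by (intro card_mono sub) (auto intro: finite_bwd[OF finite_V assms(1)])
  also have "\<dots> \<le> card (bwd H u v E) + card {p \<in> V \<times> V. blocked H u v E p}"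
    by (rule card_Un_le)
  finally show ?thesis using assms
    by (simp add: card_cartesian_product flip: card_nbrs_diff[OF assms(1,2,5)] of_nat_mult of_nat_add)
qed

text \<open>Three uses of the crude bound: \<open>ux\<close> and \<open>vy\<close> together cost
  \<open>K\<close> times d_x d_y, and \<open>xy\<close> costs a further 2 d_x d_y / N, or nothing if
  it lies in \<open>H\<close>. For \<open>x = y\<close> there is no third edge.\<close>

lemma card_blocked_le:
  assumes uv: "u \<in> V" "v \<in> V" "u \<noteq> v" and H: "finite H" "card H \<le> 1" and xy: "x \<in> V" "y \<in> V"
  defines "K \<equiv> 4 * real (d u) * real (d v) / N\<^sup>2 * c H"
  shows "real (card {E \<in> containing V d H - containing V d (insert {u, v} H). blocked H u v E (x, y)}) \<le>
    K * (2 / N * ((real (d x))\<^sup>2 * (real (d y))\<^sup>2) + real (d x) * real (d y) * of_bool ({x, y} \<in> H)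
         + (if x = y then (real (d x))\<^sup>2 else 0))"
    (is "real (card ?S) \<le> K * ?R")
proof (cases "?S = {}")
  case True
  have "0 \<le> K" using N_pos by (simp add: K_def)
  then have "0 \<le> K * ?R" using N_pos by (intro mult_nonneg_nonneg add_nonneg_nonneg) auto
  then show ?thesis unfolding True by simp
next
  case False
  then obtain E where E: "E \<in> graphs V d" "{u, v} \<notin> E" "{u, x} \<in> E" "{v, y} \<in> E" "{u, x} \<notin> H" "{v, y} \<notin> H"
    by (auto simp: blocked_def containing_def)
  \<comment> \<open>Since \<open>uv\<close> is absent, \<open>x\<close> and \<open>y\<close> avoid
    \<open>u\<close> and \<open>v\<close>. Hence no edge coincides with one added before it, and
    those indicators in the crude bound vanish.\<close>
  have ne: "x \<noteq> u" "x \<noteq> v" "y \<noteq> u" "y \<noteq> v"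
    using E graphs_edgeD[OF E(1)] by (auto simp: insert_commute)
  let ?H1 = "insert {u, x} H" and ?H2 = "insert {v, y} (insert {u, x} H)"
  have c1: "card ?H1 \<le> 2" using H by (auto simp: card_insert_if)
  have c2: "card ?H2 \<le> 3" using H by (auto simp: card_insert_if)
  have "c ?H1 \<le> (2 * real (d u) * real (d x) / N) * c H"
    using c_insert_le[of u x H] uv xy H E by simp
  moreover have "c ?H2 \<le> (2 * real (d v) * real (d y) / N) * c ?H1"
    using c_insert_le[of v y ?H1] uv xy H E c1 ne by (simp add: doubleton_eq_iff)
  ultimately have "c ?H2 \<le> (2 * real (d v) * real (d y) / N) * ((2 * real (d u) * real (d x) / N) * c H)"
    using N_pos by (meson order_trans mult_left_mono divide_nonneg_pos mult_nonneg_nonneg of_nat_0_le_iff zero_le_numeral)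
  also have "\<dots> = K * (real (d x) * real (d y))" by (simp add: K_def power2_eq_square)
  finally have h2: "c ?H2 \<le> K * (real (d x) * real (d y))" .
  show ?thesis
  proof (cases "x = y")
    case True
    have "?S \<subseteq> containing V d ?H2" using True by (auto simp: containing_def blocked_def)
    then have "real (card ?S) \<le> c ?H2" unfolding c_def by (intro of_nat_mono card_mono) auto
    also have "\<dots> \<le> K * (real (d x))\<^sup>2" using h2 True by (simp add: power2_eq_square)
    also have "\<dots> \<le> K * ?R" using True N_pos by (intro mult_left_mono) (auto simp: K_def)
    finally show ?thesis .
  next
    case False
    have "?S \<subseteq> containing V d (insert {x, y} ?H2)" using False by (auto simp: containing_def blocked_def)
    then have "real (card ?S) \<le> c (insert {x, y} ?H2)" unfolding c_def by (intro of_nat_mono card_mono) auto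
    also have "\<dots> \<le> (2 * real (d x) * real (d y) / N + of_bool ({x, y} \<in> H)) * c ?H2"
      using c_insert_le[of x y ?H2] xy H c2 ne by (simp add: doubleton_eq_iff)
    also have "\<dots> \<le> (2 * real (d x) * real (d y) / N + of_bool ({x, y} \<in> H)) * (K * (real (d x) * real (d y)))"
      using N_pos by (intro mult_left_mono h2) auto
    also have "\<dots> = K * ?R" using False by (simp add: power2_eq_square algebra_simps)
    finally show ?thesis .
  qed
qed

text \<open>Summed over \<open>x\<close> and \<open>y\<close>, the three terms of the single bound
  give at most 2 D^4/N, 2 D^2 and D^2. As N \<le> D^2, each D^2 is at most D^4/N; the resulting 5
  meets the 4 in \<open>K\<close>.\<close>

lemma sum_blocked_le:
  assumes uv: "u \<in> V" "v \<in> V" "u \<noteq> v" and H: "finite H" "card H \<le> 1"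
  shows "(\<Sum>E\<in>containing V d H - containing V d (insert {u, v} H).
      real (card {p \<in> V \<times> V. blocked H u v E p})) \<le> 20 * real (d u) * real (d v) * D ^ 4 / N ^ 3 * c H"
proof -
  let ?B = "containing V d H - containing V d (insert {u, v} H)"
  define K where "K = 4 * real (d u) * real (d v) / N\<^sup>2 * c H"
  have K: "0 \<le> K" using N_pos by (simp add: K_def)
  define S where "S = (\<Sum>x\<in>V. (real (d x))\<^sup>2)"
  have S: "0 \<le> S" "S \<le> D\<^sup>2" using sum_d_sq by (auto simp: S_def intro: sum_nonneg)
  have a1: "(\<Sum>x\<in>V. \<Sum>y\<in>V. 2 / N * ((real (d x))\<^sup>2 * (real (d y))\<^sup>2)) = 2 / N * (S * S)"
    unfolding S_def sum_product by (simp only: sum_distrib_left)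
  have a3: "(\<Sum>x\<in>V. \<Sum>y\<in>V. (if x = y then (real (d x))\<^sup>2 else 0)) = S"
    unfolding S_def using finite_V by simp
  have a2: "(\<Sum>x\<in>V. \<Sum>y\<in>V. real (d x) * real (d y) * of_bool ({x, y} \<in> H)) \<le> 2 * D\<^sup>2"
  proof -
    have "(\<Sum>x\<in>V. \<Sum>y\<in>V. real (d x) * real (d y) * of_bool ({x, y} \<in> H)) \<le>
        (\<Sum>x\<in>V. \<Sum>y\<in>V. D * D * of_bool ({x, y} \<in> H))"
      using d_le_D D_nonneg by (intro sum_mono mult_right_mono mult_mono) auto
    also have "\<dots> = (\<Sum>p\<in>V \<times> V. D * D * of_bool (p \<in> {(x, y). {x, y} \<in> H}))"
      by (simp add: sum.cartesian_product case_prod_unfold)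
    also have "\<dots> = D * D * real (card ((V \<times> V) \<inter> {(x, y). {x, y} \<in> H}))"
      using finite_V by (simp flip: sum_distrib_left)
    also have "\<dots> \<le> D * D * 2"
    proof (intro mult_left_mono)
      have "card ((V \<times> V) \<inter> {(x, y). {x, y} \<in> H}) \<le> card {(x, y). {x, y} \<in> H}"
        using card_arcs_le[OF H(1)] by (intro card_mono) auto
      also have "\<dots> \<le> 2" using card_arcs_le[OF H(1)] H(2) by linarith
      finally show "real (card ((V \<times> V) \<inter> {(x, y). {x, y} \<in> H})) \<le> 2" by simp
    qed (use D_nonneg in auto)
    finally show ?thesis by (simp add: power2_eq_square)
  qed
  have "(\<Sum>E\<in>?B. real (card {p \<in> V \<times> V. blocked H u v E p})) =
      (\<Sum>p\<in>V \<times> V. real (card {E \<in> ?B. blocked H u v E p}))"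
    using finite_V by (intro sum_card_swap) auto
  also have "\<dots> = (\<Sum>x\<in>V. \<Sum>y\<in>V. real (card {E \<in> ?B. blocked H u v E (x, y)}))"
    by (simp add: sum.cartesian_product)
  also have "\<dots> \<le> (\<Sum>x\<in>V. \<Sum>y\<in>V. K * (2 / N * ((real (d x))\<^sup>2 * (real (d y))\<^sup>2) + real (d x) * real (d y) * of_bool ({x, y} \<in> H)
         + (if x = y then (real (d x))\<^sup>2 else 0)))"
    unfolding K_def by (intro sum_mono card_blocked_le uv H)
  also have "\<dots> = K * ((\<Sum>x\<in>V. \<Sum>y\<in>V. 2 / N * ((real (d x))\<^sup>2 * (real (d y))\<^sup>2)) +
      (\<Sum>x\<in>V. \<Sum>y\<in>V. real (d x) * real (d y) * of_bool ({x, y} \<in> H)) +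
      (\<Sum>x\<in>V. \<Sum>y\<in>V. (if x = y then (real (d x))\<^sup>2 else 0)))"
    by (simp only: sum.distrib sum_distrib_left[symmetric])
  also have "\<dots> \<le> K * (2 / N * (D\<^sup>2 * D\<^sup>2) + 2 * D\<^sup>2 + D\<^sup>2)"
    unfolding a1 a3 using K a2 S N_pos by (intro mult_left_mono add_mono mult_mono) auto
  also have "\<dots> \<le> K * (5 * D ^ 4 / N)"
  proof (intro mult_left_mono K)
    have "D\<^sup>2 * N \<le> D\<^sup>2 * D\<^sup>2" using N_le_D2 by (intro mult_left_mono) auto
    then have "D\<^sup>2 \<le> D ^ 4 / N" using N_pos by (simp add: pos_le_divide_eq flip: power_add)
    then show "2 / N * (D\<^sup>2 * D\<^sup>2) + 2 * D\<^sup>2 + D\<^sup>2 \<le> 5 * D ^ 4 / N"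
      by (simp flip: power_add)
  qed
  also have "\<dots> = 20 * real (d u) * real (d v) * D ^ 4 / N ^ 3 * c H"
    using N_pos by (simp add: K_def power2_eq_square power3_eq_cube)
  finally show ?thesis .
qed

lemma free_deg_bounds:
  assumes "E \<in> containing V d H" "finite H" "u \<in> V"
  shows "0 \<le> free_deg H u" "free_deg H u \<le> real (d u)"
proof -
  have E: "E \<in> graphs V d" "nbrs H u \<subseteq> nbrs E u" using assms by (auto simp: containing_def nbrs_def)
  then have "card (nbrs H u) \<le> d u"
    using card_mono[OF finite_nbrs[OF E(1)] E(2)] card_nbrs[OF E(1) assms(3)] by simp
  then show "0 \<le> free_deg H u" "free_deg H u \<le> real (d u)" by (auto simp: free_deg_def)
qed

text \<open>On average a graph with \<open>uv\<close> has N (1 - O(\<open>eps\<close>)) forward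
  switchings, and a graph without it has \<open>m * N\<close> backward ones except for the few
  blocked. So the odds of \<open>uv\<close> are close to \<open>m\<close>, and its probability to m
  / (1 + m). The main term uses the free degrees, the error bound the full ones.\<close>

lemma edge_probability:
  assumes uv: "u \<in> V" "v \<in> V" "u \<noteq> v" "{u, v} \<notin> H" and H: "finite H" "card H \<le> 1"
  defines "m \<equiv> free_deg H u * free_deg H v / N"
  shows "\<bar>c (insert {u, v} H) - m / (1 + m) * c H\<bar> \<le> 60 * eps * (real (d u) * real (d v) / N) * c H"
proof (cases "containing V d H = {}")
  case True
  then have "c H = 0" by (simp add: c_def)
  moreover have "c (insert {u, v} H) \<le> c H" by (rule c_mono) auto
  ultimately have "c (insert {u, v} H) = 0" using c_nonneg[of "insert {u, v} H"] by linarith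
  then show ?thesis using \<open>c H = 0\<close> by simp
next
  case False
  then obtain E0 where E0: "E0 \<in> containing V d H" by blast
  let ?A = "containing V d (insert {u, v} H)"
  let ?B = "containing V d H - ?A"
  let ?C = "c H" and ?c1 = "c (insert {u, v} H)"
  define l where "l = real (d u) * real (d v) / N"
  have m0: "0 \<le> m" and ml: "m \<le> l"
    using free_deg_bounds[OF E0 H(1) uv(1)] free_deg_bounds[OF E0 H(1) uv(2)] N_pos
    by (auto simp: m_def l_def intro!: divide_right_mono mult_mono)
  have c0: "0 \<le> ?C - ?c1" using c_mono[of H "insert {u, v} H"] by auto
  have sw: "(\<Sum>E\<in>?A. real (card (fwd H u v E))) = (\<Sum>E\<in>?B. real (card (bwd H u v E)))"
    using switching_count[OF finite_V uv, of d] by (metis of_nat_sum)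
  have bB: "(\<Sum>E\<in>?B. real (card (bwd H u v E))) \<le> (?C - ?c1) * (m * N)"
  proof -
    have "(\<Sum>E\<in>?B. real (card (bwd H u v E))) \<le> (\<Sum>E\<in>?B. m * N)"
    proof (intro sum_mono)
      fix E assume "E \<in> ?B"
      then have "E \<in> graphs V d" "H \<subseteq> E" by (auto simp: containing_def)
      from card_bwd_le[OF this uv(1,2) H(1)] N_pos show "real (card (bwd H u v E)) \<le> m * N"
        by (simp add: m_def)
    qed
    then show ?thesis by (simp add: c_diff)
  qed
  have up: "?c1 * (1 - 12 * eps) \<le> (?C - ?c1) * m"
  proof -
    have "?c1 * (N - 12 * D ^ 3 / N) \<le> (?C - ?c1) * (m * N)"
      using sum_fwd_ge[OF uv(1,2) H] sw bB by linarith
    moreover have "?c1 * (N - 12 * D ^ 3 / N) = ?c1 * (1 - 12 * eps) * N"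
      using N_pos by (simp add: eps_def field_simps power2_eq_square)
    ultimately have "(?c1 * (1 - 12 * eps)) * N \<le> ((?C - ?c1) * m) * N" by (simp add: mult.assoc)
    then show ?thesis using N_pos by (rule mult_right_le_imp_le)
  qed
  have lo: "(?C - ?c1) * m - 60 * eps * l * (?C - ?c1) \<le> ?c1"
  proof -
    have "(\<Sum>E\<in>?B. m * N) \<le> (\<Sum>E\<in>?B. real (card (bwd H u v E)) + real (card {p \<in> V \<times> V. blocked H u v E p}))"
    proof (intro sum_mono)
      fix E assume "E \<in> ?B"
      then have "E \<in> graphs V d" "H \<subseteq> E" by (auto simp: containing_def)
      from card_bwd_ge[OF this uv(1,2) H(1)] N_pos
      show "m * N \<le> real (card (bwd H u v E)) + real (card {p \<in> V \<times> V. blocked H u v E p})"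
        by (simp add: m_def)
    qed
    then have "(?C - ?c1) * (m * N) \<le> (\<Sum>E\<in>?B. real (card (bwd H u v E))) +
        (\<Sum>E\<in>?B. real (card {p \<in> V \<times> V. blocked H u v E p}))"
      by (simp add: c_diff sum.distrib)
    moreover have "(\<Sum>E\<in>?A. real (card (fwd H u v E))) \<le> (\<Sum>E\<in>?A. N)"
      by (intro sum_mono card_fwd_le) (auto simp: containing_def)
    ultimately have 1: "(?C - ?c1) * (m * N) \<le> ?c1 * N + 20 * real (d u) * real (d v) * D ^ 4 / N ^ 3 * ?C"
      using sw sum_blocked_le[OF uv(1-3) H] by (simp add: c_def)
    \<comment> \<open>Blocked pairs were bounded in terms of all graphs containing \<open>H\<close>,
      but the inequality needs those without \<open>uv\<close>. The crude odds convert one into the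
      other at the price of 3 D^2/N; the product then equals 60 \<open>eps\<close>^2 l N times the
      number of graphs without \<open>uv\<close>, and one factor \<open>eps\<close> is
      dropped.\<close>
    have "?c1 \<le> 2 * l * (?C - ?c1)"
      using edge_odds_le[OF uv H(1)] H(2) N_pos by (simp add: l_def field_simps)
    then have "?C \<le> (1 + 2 * l) * (?C - ?c1)" by (simp add: algebra_simps)
    also have "\<dots> \<le> (3 * D\<^sup>2 / N) * (?C - ?c1)"
    proof (intro mult_right_mono c0)
      have "l \<le> D * D / N" unfolding l_def using d_le_D[OF uv(1)] d_le_D[OF uv(2)] N_pos D_nonneg
        by (intro divide_right_mono mult_mono) auto
      moreover have "1 \<le> D\<^sup>2 / N" using N_le_D2 N_pos by simp
      ultimately show "1 + 2 * l \<le> 3 * D\<^sup>2 / N" by (simp add: power2_eq_square)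
    qed
    finally have 2: "?C \<le> (3 * D\<^sup>2 / N) * (?C - ?c1)" .
    have "20 * real (d u) * real (d v) * D ^ 4 / N ^ 3 * ?C \<le>
        20 * real (d u) * real (d v) * D ^ 4 / N ^ 3 * ((3 * D\<^sup>2 / N) * (?C - ?c1))"
      using N_pos D_nonneg by (intro mult_left_mono 2) auto
    also have "\<dots> = (60 * eps * l * (?C - ?c1)) * eps * N"
      using N_pos by (simp add: eps_def l_def field_simps power2_eq_square power_numeral_reduce)
    also have "\<dots> \<le> (60 * eps * l * (?C - ?c1)) * 1 * N"
    proof -
      have "0 \<le> l" using N_pos by (simp add: l_def)
      then show ?thesis
        using eps_bounds c0 N_pos by (intro mult_right_mono mult_left_mono) auto
    qed
    finally have "((?C - ?c1) * m - 60 * eps * l * (?C - ?c1)) * N \<le> ?c1 * N"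
      using 1 by (simp add: algebra_simps)
    then show ?thesis using N_pos by (rule mult_right_le_imp_le)
  qed
  have cc: "0 \<le> ?c1" "?c1 \<le> ?C" "0 \<le> l" using c0 N_pos by (auto simp: l_def)
  have upper: "?c1 - m / (1 + m) * ?C \<le> 60 * eps * l * ?C"
  proof -
    have "?c1 * (1 + m) - m * ?C \<le> 12 * eps * ?c1" using up by (simp add: algebra_simps)
    moreover have "?c1 \<le> 2 * m * ?C"
    proof -
      have "?c1 * (1/2) \<le> ?c1 * (1 - 12 * eps)" using eps_bounds cc by (intro mult_left_mono) auto
      also have "\<dots> \<le> ?C * m" using up mult_right_mono[of "?C - ?c1" "?C" m] m0 cc by linarith
      finally show ?thesis by (simp add: mult_ac)
    qed
    then have "12 * eps * ?c1 \<le> 12 * eps * (2 * m * ?C)" using eps_bounds by (intro mult_left_mono) auto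
    moreover have "12 * eps * (2 * m * ?C) = 24 * eps * m * ?C" by simp
    ultimately have "?c1 * (1 + m) - m * ?C \<le> 24 * eps * m * ?C" by linarith
    also have "\<dots> \<le> (60 * eps * l * ?C)" using eps_bounds ml m0 cc by (intro mult_right_mono mult_mono) auto
    also have "\<dots> \<le> (60 * eps * l * ?C) * (1 + m)"
      using eps_bounds m0 cc mult_left_mono[of 1 "1 + m" "60 * eps * l * ?C"] by simp
    finally have "?c1 * (1 + m) - m * ?C \<le> (60 * eps * l * ?C) * (1 + m)" .
    then have "(?c1 * (1 + m) - m * ?C) / (1 + m) \<le> 60 * eps * l * ?C" using m0 by (simp add: pos_divide_le_eq)
    moreover have "(?c1 * (1 + m) - m * ?C) / (1 + m) = ?c1 - m / (1 + m) * ?C"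
      using m0 by (simp add: field_simps)
    ultimately show ?thesis by simp
  qed
  have lower: "m / (1 + m) * ?C - ?c1 \<le> 60 * eps * l * ?C"
  proof -
    have "60 * eps * l * (?C - ?c1) \<le> 60 * eps * l * ?C" using eps_bounds cc by (intro mult_left_mono) auto
    then have "m * ?C - ?c1 * (1 + m) \<le> 60 * eps * l * ?C" using lo by (simp add: algebra_simps)
    also have "\<dots> \<le> (60 * eps * l * ?C) * (1 + m)"
      using eps_bounds m0 cc mult_left_mono[of 1 "1 + m" "60 * eps * l * ?C"] by simp
    finally have "(m * ?C - ?c1 * (1 + m)) / (1 + m) \<le> 60 * eps * l * ?C" using m0 by (simp add: pos_divide_le_eq)
    moreover have "(m * ?C - ?c1 * (1 + m)) / (1 + m) = m / (1 + m) * ?C - ?c1"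
      using m0 by (simp add: field_simps)
    ultimately show ?thesis by simp
  qed
  from upper lower show ?thesis unfolding l_def by (simp add: abs_le_iff)
qed

end

section \<open>The increment of the exponent\<close>

text \<open>With k = d_a and t = d_x, \<open>F\<close> is the change of the logarithms involving x
  when a leaf is merged into a, and t/N * m/(1+m) is the main term for the path b-x-a. Exactly, F =
  ln (1 - w) with w = k t^2 / ((N + k t) (N + t)). Linearising the logarithm, replacing N + t by N,
  and comparing with the path term cost 2, 1 and 2 units of e k t^2 / N^2. The remainder k t / N^2
  is kept because its sum over x is not negligible.\<close>

lemma ln_ratio_expansion:
  fixes N k t e :: real
  assumes N: "0 < N" and k: "0 \<le> k" "k / N \<le> e" and t: "t = 0 \<or> 1 \<le> t" "t / N \<le> e" and e: "e \<le> 1 / 4"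
  defines "F \<equiv> ln (1 + (k + 1) * t / N) - ln (1 + k * t / N) - ln (1 + t / N)"
    and "m \<equiv> (t - 1) * k / N"
  shows "\<bar>F + t / N * (m / (1 + m)) + k * t / N\<^sup>2\<bar> \<le> 5 * e * (k * t\<^sup>2 / N\<^sup>2)"
proof (cases "t = 0")
  case True
  then show ?thesis by (simp add: F_def)
next
  case False
  then have t1: "1 \<le> t" using t by simp
  define A where "A = N + k * t"
  define B where "B = N + (t - 1) * k"
  define w where "w = k * t\<^sup>2 / (A * (N + t))"
  define z where "z = k * t\<^sup>2 / N\<^sup>2"
  have A: "N \<le> A" "0 < A" "0 < N + t" using N k t1 by (auto simp: A_def add_pos_nonneg)
  have B: "N \<le> B" "0 < B" using N k t1 by (auto simp: B_def add_pos_nonneg)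
  have z0: "0 \<le> z" using k by (simp add: z_def)
  have w0: "0 \<le> w" using k A by (simp add: w_def)
  have wz: "w \<le> z"
    unfolding w_def z_def power2_eq_square[of N] using A N k t1
    by (intro divide_left_mono mult_mono) auto
  have wt: "w \<le> t / N"
  proof -
    have "w = (k * t / A) * (t / (N + t))" by (simp add: w_def power2_eq_square)
    also have "\<dots> \<le> 1 * (t / N)"
      using A N k t1 by (intro mult_mono divide_left_mono) (auto simp: A_def divide_le_eq_1)
    finally show ?thesis by simp
  qed
  have w12: "w \<le> 1 / 2" using wt t e by linarith
  have F: "F = ln (1 - w)"
  proof -
    have "1 - w = (1 + (k + 1) * t / N) / ((1 + k * t / N) * (1 + t / N))"
    proof -
      have "1 - w = (A * (N + t) - k * t\<^sup>2) / (A * (N + t))" using A by (simp add: w_def diff_divide_distrib)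
      also have "A * (N + t) - k * t\<^sup>2 = N * (N + (k + 1) * t)"
        by (simp add: A_def algebra_simps power2_eq_square)
      also have "N * (N + (k + 1) * t) / (A * (N + t)) = ((N + (k + 1) * t) / N) / ((A / N) * ((N + t) / N))"
        using N A by simp
      also have "(N + (k + 1) * t) / N = 1 + (k + 1) * t / N" using N by (simp add: add_divide_distrib)
      also have "A / N = 1 + k * t / N" using N by (simp add: A_def add_divide_distrib)
      also have "(N + t) / N = 1 + t / N" using N by (simp add: add_divide_distrib)
      finally show ?thesis .
    qed
    moreover have "0 < 1 + (k + 1) * t / N" "0 < 1 + k * t / N" "0 < 1 + t / N"
      using N k t1 by (auto intro!: add_pos_nonneg)
    ultimately show ?thesis by (simp add: F_def ln_div ln_mult)
  qed
  have 1: "\<bar>F + w\<bar> \<le> 2 * e * z"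
  proof -
    have "\<bar>ln (1 + (- w)) - (- w)\<bar> \<le> 2 * (- w)\<^sup>2"
      using w0 w12 by (intro abs_ln_one_plus_x_minus_x_bound) auto
    then have "\<bar>F + w\<bar> \<le> 2 * (w * w)" unfolding F by (simp add: power2_eq_square)
    also have "w * w \<le> e * z" using wt wz w0 t by (intro mult_mono) auto
    finally show ?thesis by simp
  qed
  define w' where "w' = k * t\<^sup>2 / (N * A)"
  have 2: "\<bar>w' - w\<bar> \<le> e * z"
  proof -
    have "w' - w = k * t\<^sup>2 / (N * A) * (t / (N + t))"
    proof -
      have "1 / N - 1 / (N + t) = t / (N * (N + t))" using A N by (simp add: diff_frac_eq)
      moreover have "w' - w = k * t\<^sup>2 / A * (1 / N - 1 / (N + t))"
        by (simp add: w'_def w_def right_diff_distrib diff_divide_distrib mult.commute)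
      ultimately show ?thesis by (simp add: mult_ac)
    qed
    also have "\<dots> \<le> z * (t / N)"
      unfolding z_def power2_eq_square[of N] using A N k t1
      by (intro mult_mono divide_left_mono) auto
    also have "\<dots> \<le> z * e" using t z0 by (intro mult_left_mono) auto
    finally have "w' - w \<le> e * z" by (simp add: mult.commute)
    moreover have "0 \<le> w' - w"
      unfolding w'_def w_def using A N k t1 by (simp, intro divide_left_mono) (auto simp: mult.commute mult_mono)
    ultimately show ?thesis by simp
  qed
  have 3: "\<bar>w' - t / N * (m / (1 + m)) - k * t / N\<^sup>2\<bar> \<le> 2 * e * z"
  proof -
    have "1 + m = B / N" using N by (simp add: m_def B_def field_simps)
    then have mm: "m / (1 + m) = (t - 1) * k / B" using N B by (simp add: m_def)
    \<comment> \<open>All products with k cancel in the numerator, so \<open>w'\<close> exceeds the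
      path term by exactly k t / (A B), which is close to k t / N^2.\<close>
    have "t / A - (t - 1) / B = (t * B - (t - 1) * A) / (A * B)" using A B by (simp add: diff_frac_eq)
    also have "t * B - (t - 1) * A = N" by (simp add: A_def B_def algebra_simps)
    finally have "t / A - (t - 1) / B = N / (A * B)" .
    moreover have "w' - t / N * (m / (1 + m)) = k * t / N * (t / A - (t - 1) / B)"
      unfolding mm w'_def by (simp add: right_diff_distrib diff_divide_distrib power2_eq_square mult_ac)
    ultimately have q: "w' - t / N * (m / (1 + m)) = k * t / (A * B)" using N by simp
    have "k * t / N\<^sup>2 - k * t / (A * B) = k * t / N\<^sup>2 * ((A * B - N * N) / (A * B))"
      using A B N by (simp add: field_simps power2_eq_square)
    also have "\<dots> \<le> k * t / N\<^sup>2 * (2 * k * t / N)"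
    proof (intro mult_left_mono)
      have "A * B - N * N = (A - N) * B + N * (B - N)" by (simp add: algebra_simps)
      also have "\<dots> \<le> (k * t) * B + A * (k * t)"
        using A B N k t1 by (intro add_mono mult_mono) (auto simp: A_def B_def algebra_simps)
      finally have "(A * B - N * N) / (A * B) \<le> (k * t * B + A * (k * t)) / (A * B)"
        using A B by (intro divide_right_mono) auto
      also have "\<dots> = k * t / A + k * t / B" using A B by (simp add: field_simps)
      also have "\<dots> \<le> k * t / N + k * t / N" using A B N k t1 by (intro add_mono divide_left_mono) auto
      finally show "(A * B - N * N) / (A * B) \<le> 2 * k * t / N" by simp
    qed (use k t1 in auto)
    also have "\<dots> = 2 * (k / N) * z" by (simp add: z_def power2_eq_square mult_ac)
    also have "\<dots> \<le> 2 * e * z" using k z0 by (intro mult_right_mono) auto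
    finally have "k * t / N\<^sup>2 - k * t / (A * B) \<le> 2 * e * z" .
    moreover have "k * t / (A * B) \<le> k * t / N\<^sup>2"
      unfolding power2_eq_square using A B N k t1 by (intro divide_left_mono mult_mono) auto
    ultimately show ?thesis unfolding q by simp
  qed
  have "\<bar>F + t / N * (m / (1 + m)) + k * t / N\<^sup>2\<bar> \<le> \<bar>F + w\<bar> + \<bar>w' - w\<bar> + \<bar>w' - t / N * (m / (1 + m)) - k * t / N\<^sup>2\<bar>"
    by linarith
  also have "\<dots> \<le> 5 * (e * z)" using 1 2 3 by linarith
  finally show ?thesis by (simp add: z_def)
qed

text \<open>Half of the sum over ordered pairs: for symmetric \<open>f\<close> this is the sum over
  i < j, without an order on the vertices.\<close>

definition pair_sum :: "'a set \<Rightarrow> ('a \<Rightarrow> 'a \<Rightarrow> real) \<Rightarrow> real" where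
  "pair_sum V f = (\<Sum>i\<in>V. \<Sum>j\<in>V - {i}. f i j) / 2"

lemma pair_sum_insert:
  assumes "finite W" "a \<notin> W" "\<And>i j. f i j = f j i"
  shows "pair_sum (insert a W) f = pair_sum W f + (\<Sum>x\<in>W. f a x)"
proof -
  have "(\<Sum>i\<in>W. \<Sum>j\<in>insert a W - {i}. f i j) = (\<Sum>i\<in>W. f i a + (\<Sum>j\<in>W - {i}. f i j))"
  proof (intro sum.cong refl)
    fix i assume "i \<in> W"
    then have "insert a W - {i} = insert a (W - {i})" using assms by auto
    then show "(\<Sum>j\<in>insert a W - {i}. f i j) = f i a + (\<Sum>j\<in>W - {i}. f i j)" using assms by simp
  qed
  moreover have "(\<Sum>i\<in>W. f i a) = (\<Sum>i\<in>W. f a i)" by (intro sum.cong assms(3) refl)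
  ultimately show ?thesis using assms(1,2) by (simp add: pair_sum_def sum.distrib)
qed

text \<open>The part of the exponent of the formula that changes when two vertices are merged and the
  number of points \<open>N\<close> is kept.\<close>

definition exponent :: "real \<Rightarrow> 'a set \<Rightarrow> ('a \<Rightarrow> nat) \<Rightarrow> real" where
  "exponent N V d = (\<Sum>i\<in>V. real (d i) * (real (d i) - 1)) / (2 * N) +
     pair_sum V (\<lambda>i j. ln (1 + real (d i) * real (d j) / N))"

lemma pair_sum_cong:
  assumes "\<And>i j. i \<in> V \<Longrightarrow> j \<in> V \<Longrightarrow> i \<noteq> j \<Longrightarrow> f i j = g i j"
  shows "pair_sum V f = pair_sum V g"
  unfolding pair_sum_def using assms by (auto intro!: sum.cong arg_cong[where f = "\<lambda>x. x / 2"])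

text \<open>The merger raises M2 by (k + 1) k - k (k - 1) = 2 k. The pair ab loses its term ln (1 +
  k/N), and every other x exchanges its two pairs with a and b for one pair with a vertex of degree
  k + 1.\<close>

lemma exponent_merge:
  fixes V :: "'a set" and d :: "'a \<Rightarrow> nat"
  assumes V: "finite V" "a \<in> V" "b \<in> V" "a \<noteq> b" and d: "d b = 1"
  defines "k \<equiv> real (d a)" and "W \<equiv> V - {a, b}"
  shows "exponent N V (d(a := d a + 1, b := 0)) - exponent N V d = k / N - ln (1 + k / N) +
    (\<Sum>x\<in>W. ln (1 + (k + 1) * real (d x) / N) - ln (1 + k * real (d x) / N) - ln (1 + real (d x) / N))"
proof -
  let ?e = "d(a := d a + 1, b := 0)"
  have W: "finite W" "a \<notin> insert b W" "b \<notin> W" "V = insert a (insert b W)" using V by (auto simp: W_def)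
  have ne: "x \<noteq> a" "x \<noteq> b" if "x \<in> W" for x using that by (auto simp: W_def)
  have P: "pair_sum V (\<lambda>i j. ln (1 + real (h i) * real (h j) / N)) =
      pair_sum W (\<lambda>i j. ln (1 + real (h i) * real (h j) / N)) +
      (\<Sum>x\<in>W. ln (1 + real (h b) * real (h x) / N)) + ln (1 + real (h a) * real (h b) / N) +
      (\<Sum>x\<in>W. ln (1 + real (h a) * real (h x) / N))" for h :: "'a \<Rightarrow> nat"
  proof -
    have sym: "ln (1 + real (h i) * real (h j) / N) = ln (1 + real (h j) * real (h i) / N)" for i j
      by (simp add: mult.commute)
    have "pair_sum (insert a (insert b W)) (\<lambda>i j. ln (1 + real (h i) * real (h j) / N)) =
        pair_sum (insert b W) (\<lambda>i j. ln (1 + real (h i) * real (h j) / N)) +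
        (\<Sum>x\<in>insert b W. ln (1 + real (h a) * real (h x) / N))"
      by (rule pair_sum_insert[OF _ _ sym]) (use W in auto)
    moreover have "pair_sum (insert b W) (\<lambda>i j. ln (1 + real (h i) * real (h j) / N)) =
        pair_sum W (\<lambda>i j. ln (1 + real (h i) * real (h j) / N)) +
        (\<Sum>x\<in>W. ln (1 + real (h b) * real (h x) / N))"
      by (rule pair_sum_insert[OF _ _ sym]) (use W in auto)
    ultimately show ?thesis unfolding W(4) using W(1,3) by simp
  qed
  have PW: "pair_sum W (\<lambda>i j. ln (1 + real (?e i) * real (?e j) / N)) =
    pair_sum W (\<lambda>i j. ln (1 + real (d i) * real (d j) / N))"
    by (rule pair_sum_cong) (use ne in auto)
  have SW: "(\<Sum>x\<in>W. f (?e x)) = (\<Sum>x\<in>W. f (d x))" for f :: "nat \<Rightarrow> real"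
    by (rule sum.cong) (use ne in auto)
  have Q: "(\<Sum>i\<in>V. real (h i) * (real (h i) - 1)) = real (h a) * (real (h a) - 1) +
      real (h b) * (real (h b) - 1) + (\<Sum>i\<in>W. real (h i) * (real (h i) - 1))" for h :: "'a \<Rightarrow> nat"
    unfolding W(4) using W by simp
  have Q2: "(\<Sum>i\<in>V. real (?e i) * (real (?e i) - 1)) - (\<Sum>i\<in>V. real (d i) * (real (d i) - 1)) = 2 * k"
    unfolding Q SW[of "\<lambda>x. real x * (real x - 1)"] using V d by (simp add: k_def algebra_simps)
  have "exponent N V ?e - exponent N V d = 2 * k / (2 * N) +
     (pair_sum V (\<lambda>i j. ln (1 + real (?e i) * real (?e j) / N)) - pair_sum V (\<lambda>i j. ln (1 + real (d i) * real (d j) / N)))"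
    unfolding exponent_def Q2[symmetric] by (simp add: diff_divide_distrib)
  also have "\<dots> = k / N - ln (1 + k / N) +
    (\<Sum>x\<in>W. ln (1 + (k + 1) * real (d x) / N) - ln (1 + k * real (d x) / N) - ln (1 + real (d x) / N))"
    unfolding P PW SW[of "\<lambda>x. ln (1 + real (?e a) * real x / N)"] SW[of "\<lambda>x. ln (1 + real (?e b) * real x / N)"]
    using V d by (simp add: k_def sum_subtractf add.commute)
  finally show ?thesis .
qed

section \<open>The effect of a single merger on the count and on the exponent\<close>

context sparse_degrees
begin

lemma D_div_N_le_eps: "D / N \<le> eps"
proof -
  have "D * N \<le> D * D\<^sup>2" using N_le_D2 D_nonneg by (intro mult_left_mono)
  then have "D * N / N\<^sup>2 \<le> D * D\<^sup>2 / N\<^sup>2" by (rule divide_right_mono) simp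
  then show ?thesis using N_pos by (simp add: eps_def power2_eq_square power3_eq_cube)
qed

lemma c_empty: "c {} = real (card (graphs V d))"
  by (simp add: c_def containing_def)

text \<open>At a leaf the odds t = d_x/N are at most D/N \<le> \<open>eps\<close>, so t / (1 + t)
  may be replaced by t; this turns 60 into 61.\<close>

lemma leaf_edge_estimate:
  assumes V: "b \<in> V" and db: "d b = 1" and x: "x \<in> V" "x \<noteq> b"
  shows "\<bar>c {{b, x}} - real (d x) / N * c {}\<bar> \<le> 61 * eps * (real (d x) / N) * c {}"
proof -
  define t where "t = real (d x) / N"
  have t: "0 \<le> t" "t \<le> eps"
    using N_pos divide_right_mono[OF d_le_D[OF x(1)], of N] D_div_N_le_eps by (auto simp: t_def)
  have "\<bar>c {{b, x}} - t / (1 + t) * c {}\<bar> \<le> 60 * eps * t * c {}"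
    using edge_probability[of b x "{}"] V x db by (simp add: free_deg_def nbrs_def t_def)
  moreover have "\<bar>t / (1 + t) * c {} - t * c {}\<bar> \<le> eps * t * c {}"
  proof -
    have "t / (1 + t) - t = - (t * t / (1 + t))" using t by (simp add: field_simps)
    moreover have "t * t / (1 + t) \<le> eps * t"
    proof -
      have "t * t * 1 \<le> t * t * (1 + t)" using t by (intro mult_left_mono) auto
      then have "t * t / (1 + t) \<le> t * t" using t by (simp add: divide_le_eq)
      also have "\<dots> \<le> eps * t" using t by (intro mult_right_mono) auto
      finally show ?thesis .
    qed
    moreover have "0 \<le> t * t / (1 + t)" using t by simp
    ultimately have "\<bar>t / (1 + t) - t\<bar> \<le> eps * t" by linarith
    then have "\<bar>t / (1 + t) - t\<bar> * c {} \<le> eps * t * c {}" by (intro mult_right_mono) auto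
    moreover have "t / (1 + t) * c {} - t * c {} = (t / (1 + t) - t) * c {}"
      by (rule left_diff_distrib[symmetric])
    ultimately show ?thesis by (simp only: abs_mult abs_of_nonneg[OF c_nonneg])
  qed
  moreover have "\<bar>A - C\<bar> \<le> p + q" if "\<bar>A - B\<bar> \<le> p" "\<bar>B - C\<bar> \<le> q" for A B C p q :: real
    using that by linarith
  ultimately have "\<bar>c {{b, x}} - t * c {}\<bar> \<le> 60 * eps * t * c {} + eps * t * c {}" by blast
  then show ?thesis unfolding t_def[symmetric] by (simp add: algebra_simps)
qed

text \<open>Conditioning on \<open>bx\<close> uses up one edge at \<open>x\<close>, so
  \<open>xa\<close> then has odds \<open>m\<close>, with d_x - 1 in place of d_x. The constant is
  181 = 60 * 2 + 61, where 2 comes from the crude bound on \<open>c {{b, x}}\<close>.\<close>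

lemma leaf_path_estimate:
  assumes V: "a \<in> V" "b \<in> V" "a \<noteq> b" and db: "d b = 1" and x: "x \<in> V" "x \<noteq> b" "x \<noteq> a"
  defines "m \<equiv> (real (d x) - 1) * real (d a) / N"
  shows "\<bar>c {{x, a}, {b, x}} - real (d x) / N * (m / (1 + m)) * c {}\<bar> \<le>
    181 * eps * (real (d a) * (real (d x))\<^sup>2 / N\<^sup>2) * c {}"
proof (cases "d x = 0")
  case True
  have "c {{b, x}} \<le> 0" using c_insert_le[of b x "{}"] V x True by simp
  moreover have "c {{x, a}, {b, x}} \<le> c {{b, x}}" by (rule c_mono) auto
  ultimately have "c {{x, a}, {b, x}} = 0" using c_nonneg[of "{{x, a}, {b, x}}"] by linarith
  then show ?thesis using True by simp
next
  case False
  define t where "t = real (d x) / N"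
  define l where "l = real (d a) * t"
  define q where "q = m / (1 + m)"
  have t: "0 \<le> t" "t \<le> eps"
    using N_pos divide_right_mono[OF d_le_D[OF x(1)], of N] D_div_N_le_eps by (auto simp: t_def)
  have l: "0 \<le> l" using t by (simp add: l_def)
  have m: "0 \<le> m" "m \<le> l"
  proof -
    show "0 \<le> m" using False N_pos by (simp add: m_def)
    have "(real (d x) - 1) * real (d a) / N \<le> real (d x) * real (d a) / N"
      using N_pos by (intro divide_right_mono mult_right_mono) auto
    then show "m \<le> l" by (simp add: m_def l_def t_def mult.commute)
  qed
  have q: "0 \<le> q" "q \<le> l"
  proof -
    show "0 \<le> q" using m by (simp add: q_def)
    have "q \<le> m" using m by (simp add: q_def divide_le_eq algebra_simps)
    with m show "q \<le> l" by simp
  qed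
  have "{y. {x, y} \<in> {{b, x}}} = {b}" "{y. {a, y} \<in> {{b, x}}} = {}"
    using V x by (auto simp: doubleton_eq_iff)
  then have "\<bar>c {{x, a}, {b, x}} - q * c {{b, x}}\<bar> \<le> 60 * eps * l * c {{b, x}}"
    using edge_probability[of x a "{{b, x}}"] V x
    by (simp add: free_deg_def nbrs_def q_def m_def l_def t_def doubleton_eq_iff mult_ac)
  also have "\<dots> \<le> 60 * eps * l * (2 * t * c {})"
    using c_insert_le[of b x "{}"] V x db eps_bounds l by (intro mult_left_mono) (auto simp: t_def)
  finally have 1: "\<bar>c {{x, a}, {b, x}} - q * c {{b, x}}\<bar> \<le> 120 * (eps * l * t * c {})" by simp
  have "\<bar>q * (c {{b, x}} - t * c {})\<bar> = q * \<bar>c {{b, x}} - t * c {}\<bar>" using q by (simp add: abs_mult)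
  also have "\<dots> \<le> l * (61 * eps * t * c {})"
    using leaf_edge_estimate[OF V(2) db x(1,2)] q l by (intro mult_mono) (auto simp: t_def)
  finally have 2: "\<bar>q * c {{b, x}} - t * q * c {}\<bar> \<le> 61 * (eps * l * t * c {})"
    by (simp add: algebra_simps)
  have "\<bar>c {{x, a}, {b, x}} - t * q * c {}\<bar> \<le> 181 * (eps * l * t * c {})" using 1 2 by linarith
  moreover have "eps * l * t * c {} = eps * (real (d a) * (real (d x))\<^sup>2 / N\<^sup>2) * c {}"
    by (simp add: l_def t_def power2_eq_square)
  ultimately show ?thesis by (simp add: t_def q_def mult.assoc)
qed

lemma sum_leaf_edges:
  assumes "b \<in> V" "d b = 1"
  shows "(\<Sum>x\<in>V. c {{b, x}}) = c {}"
proof -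
  have "(\<Sum>x\<in>V. c {{b, x}}) = (\<Sum>x\<in>V. real (card {E \<in> graphs V d. {b, x} \<in> E}))"
    by (simp add: c_def containing_def)
  also have "\<dots> = (\<Sum>E\<in>graphs V d. real (card {x \<in> V. {b, x} \<in> E}))"
    using finite_V finite_graphs by (intro sum_card_swap[symmetric]) auto
  also have "\<dots> = (\<Sum>E\<in>graphs V d. 1)"
  proof (intro sum.cong refl)
    fix E assume E: "E \<in> graphs V d"
    then have "{x \<in> V. {b, x} \<in> E} = nbrs E b" by (auto simp: nbrs_def dest: graphs_edgeD)
    then show "real (card {x \<in> V. {b, x} \<in> E}) = 1" using card_nbrs[OF E assms(1)] assms by simp
  qed
  finally show ?thesis by (simp add: c_empty)
qed

text \<open>A leaf has a single neighbour, so adjacency to \<open>a\<close> and the various paths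
  b-x-a exclude each other; the destroyed graphs are counted exactly by a plain sum.\<close>

lemma merge_count:
  assumes V: "a \<in> V" "b \<in> V" "a \<noteq> b" and db: "d b = 1"
  shows "(real (d a) + 1) * real (card (graphs V (d(a := d a + 1, b := 0)))) =
    c {} - (c {{b, a}} + (\<Sum>x\<in>V - {a, b}. c {{x, a}, {b, x}}))"
proof -
  have cb: "real (card {E \<in> containing V d {{b, x}}. {x, a} \<notin> E}) = c {{b, x}} - c {{x, a}, {b, x}}" for x
  proof -
    have "{E \<in> containing V d {{b, x}}. {x, a} \<notin> E} = containing V d {{b, x}} - containing V d (insert {x, a} {{b, x}})"
      by (auto simp: containing_def)
    then show ?thesis by (simp only: c_diff)
  qed
  have "c {{b, b}} = 0"
  proof -
    have "containing V d {{b, b}} = {}" by (auto simp: containing_def dest: graphs_edgeD[of _ _ _ b b])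
    then show ?thesis by (simp add: c_def)
  qed
  moreover have "(\<Sum>x\<in>V. c {{b, x}}) = c {{b, a}} + (c {{b, b}} + (\<Sum>x\<in>V - {a, b}. c {{b, x}}))"
    using V finite_V by (simp add: sum.remove[of V a] sum.remove[of "V - {a}" b] Diff_insert2[of V a "{b}"])
  ultimately have S: "(\<Sum>x\<in>V - {a, b}. c {{b, x}}) = c {} - c {{b, a}}"
    using sum_leaf_edges[OF V(2) db] by simp
  have "(real (d a) + 1) * real (card (graphs V (d(a := d a + 1, b := 0)))) =
     real ((d a + 1) * card (graphs V (d(a := d a + 1, b := 0))))"
    by (simp add: algebra_simps)
  also have "\<dots> = (\<Sum>x\<in>V - {a, b}. real (card {E \<in> containing V d {{b, x}}. {x, a} \<notin> E}))"
    unfolding merge_leaf_count[where d = d, OF finite_V V db] by simp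
  also have "\<dots> = c {} - (c {{b, a}} + (\<Sum>x\<in>V - {a, b}. c {{x, a}, {b, x}}))"
    by (simp add: cb sum_subtractf S)
  finally show ?thesis .
qed

text \<open>\<open>P\<close> is the destroyed fraction and \<open>Q\<close> its main term. In units
  of \<open>eps * \<tau>\<close>, P - Q costs 61 + 181 = 242, ln (1 - P) against - P costs 2 * 3 * 3
  = 18, and the increment of the exponent against - Q costs 7; the sum 267 is rounded to 300. The
  summand ln (d_a + 1) is the growth of ln (d_a!). Since P \<le> 1/2, graphs remain and the next
  merger can start.\<close>

lemma merge_step:
  assumes V: "a \<in> V" "b \<in> V" "a \<noteq> b" and db: "d b = 1" and da: "1 \<le> d a" "real (d a) + 1 \<le> D"
    and pos: "0 < card (graphs V d)"
  defines "d' \<equiv> d(a := d a + 1, b := 0)"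
  shows "0 < card (graphs V d')"
    and "\<bar>(ln (real (d a) + 1) + ln (real (card (graphs V d'))) - exponent N V d') -
      (ln (real (card (graphs V d))) - exponent N V d)\<bar> \<le> 300 * eps * (real (d a) * D\<^sup>2 / N\<^sup>2)"
proof -
  define k where "k = real (d a)"
  define W where "W = V - {a, b}"
  define g where "g = c {}"
  have g: "0 < g" using pos by (simp add: g_def c_empty)
  have W: "finite W" "W \<subseteq> V" "a \<notin> W" "b \<notin> W" "V = insert a (insert b W)"
    using finite_V V by (auto simp: W_def)
  have k: "1 \<le> k" "k + 1 \<le> D" using da by (auto simp: k_def)
  define q where "q x = real (d x) / N * (((real (d x) - 1) * k / N) / (1 + (real (d x) - 1) * k / N))" for x
  define Q where "Q = k / N + (\<Sum>x\<in>W. q x)"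
  define P where "P = (c {{b, a}} + (\<Sum>x\<in>W. c {{x, a}, {b, x}})) / g"
  \<comment> \<open>The scale of P: \<tau> bounds k/N as well as the sum of k d_x^2 / N^2, which
    dominates the path terms.\<close>
  define \<tau> where "\<tau> = k * D\<^sup>2 / N\<^sup>2"
  have kN: "0 \<le> k / N" "k / N \<le> eps"
    using k N_pos D_div_N_le_eps divide_right_mono[of k D N] by auto
  have kN\<tau>: "k / N \<le> \<tau>"
  proof -
    have "k * N / N\<^sup>2 \<le> \<tau>" unfolding \<tau>_def using N_le_D2 k by (intro divide_right_mono mult_left_mono) auto
    then show ?thesis using N_pos by (simp add: power2_eq_square)
  qed
  have \<tau>0: "0 \<le> \<tau>" using kN kN\<tau> by linarith
  have \<tau>e: "\<tau> \<le> eps"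
    using k D_nonneg unfolding \<tau>_def eps_def
    by (intro divide_right_mono) (auto simp: power2_eq_square power3_eq_cube mult_right_mono)
  have sqW: "(\<Sum>x\<in>W. k * (real (d x))\<^sup>2 / N\<^sup>2) \<le> \<tau>"
  proof -
    have "(\<Sum>x\<in>W. (real (d x))\<^sup>2) \<le> (\<Sum>x\<in>V. (real (d x))\<^sup>2)"
      using W finite_V by (intro sum_mono2) auto
    then have "k * (\<Sum>x\<in>W. (real (d x))\<^sup>2) / N\<^sup>2 \<le> \<tau>"
      unfolding \<tau>_def using sum_d_sq k by (intro divide_right_mono mult_left_mono) auto
    then show ?thesis by (simp add: sum_distrib_left sum_divide_distrib)
  qed
  have PQ: "\<bar>P - Q\<bar> \<le> 242 * (eps * \<tau>)"
  proof -
    have "\<bar>c {{b, a}} - k / N * g\<bar> \<le> 61 * eps * (k / N) * g"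
      using leaf_edge_estimate[OF V(2) db V(1) V(3)] by (simp add: k_def g_def)
    also have "\<dots> \<le> 61 * eps * \<tau> * g"
      using eps_bounds g kN\<tau> by (intro mult_right_mono mult_left_mono) auto
    finally have 1: "\<bar>c {{b, a}} - k / N * g\<bar> \<le> 61 * eps * \<tau> * g" .
    have "\<bar>\<Sum>x\<in>W. (c {{x, a}, {b, x}} - q x * g)\<bar> \<le> (\<Sum>x\<in>W. \<bar>c {{x, a}, {b, x}} - q x * g\<bar>)"
      by (rule sum_abs)
    also have "\<dots> \<le> (\<Sum>x\<in>W. 181 * eps * (k * (real (d x))\<^sup>2 / N\<^sup>2) * g)"
    proof (intro sum_mono)
      fix x assume "x \<in> W"
      then have "x \<in> V" "x \<noteq> b" "x \<noteq> a" using W by auto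
      from leaf_path_estimate[OF V db this]
      show "\<bar>c {{x, a}, {b, x}} - q x * g\<bar> \<le> 181 * eps * (k * (real (d x))\<^sup>2 / N\<^sup>2) * g"
        by (simp add: q_def k_def g_def)
    qed
    also have "\<dots> = 181 * eps * (\<Sum>x\<in>W. k * (real (d x))\<^sup>2 / N\<^sup>2) * g"
      by (simp only: sum_distrib_left sum_distrib_right)
    also have "\<dots> \<le> 181 * eps * \<tau> * g"
      using eps_bounds g sqW by (intro mult_right_mono mult_left_mono) auto
    finally have 2: "\<bar>(\<Sum>x\<in>W. c {{x, a}, {b, x}}) - (\<Sum>x\<in>W. q x) * g\<bar> \<le> 181 * eps * \<tau> * g"
      by (simp add: sum_subtractf sum_distrib_right)
    have "P * g - Q * g = (c {{b, a}} - k / N * g) + ((\<Sum>x\<in>W. c {{x, a}, {b, x}}) - (\<Sum>x\<in>W. q x) * g)"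
    proof -
      have "X / g * g = X" for X using g by simp
      then have "P * g = c {{b, a}} + (\<Sum>x\<in>W. c {{x, a}, {b, x}})" by (simp only: P_def)
      then show ?thesis by (simp add: Q_def algebra_simps)
    qed
    then have "\<bar>P * g - Q * g\<bar> \<le> 242 * (eps * \<tau>) * g" using 1 2 by linarith
    then have "\<bar>P - Q\<bar> * g \<le> 242 * (eps * \<tau>) * g" using g by (simp add: abs_mult flip: left_diff_distrib)
    then show ?thesis using g by (rule mult_right_le_imp_le)
  qed
  have q0: "0 \<le> q x \<and> q x \<le> k * (real (d x))\<^sup>2 / N\<^sup>2" for x
  proof (cases "d x = 0")
    case False
    define m where "m = (real (d x) - 1) * k / N"
    have m: "0 \<le> m" "m \<le> real (d x) * k / N"
      using False k N_pos by (auto simp: m_def intro!: divide_right_mono mult_right_mono)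
    have "m / (1 + m) \<le> m" using m by (simp add: divide_le_eq algebra_simps)
    then have "m / (1 + m) \<le> real (d x) * k / N" using m by simp
    then have "real (d x) / N * (m / (1 + m)) \<le> real (d x) / N * (real (d x) * k / N)"
      using N_pos by (intro mult_left_mono) auto
    moreover have "0 \<le> real (d x) / N * (m / (1 + m))" using m N_pos by simp
    ultimately show ?thesis by (simp add: q_def m_def power2_eq_square mult_ac)
  qed (simp add: q_def)
  have Q0: "0 \<le> Q" using kN q0 by (auto simp: Q_def intro: add_nonneg_nonneg sum_nonneg)
  have Q2: "Q \<le> 2 * \<tau>"
  proof -
    have "(\<Sum>x\<in>W. q x) \<le> (\<Sum>x\<in>W. k * (real (d x))\<^sup>2 / N\<^sup>2)" using q0 by (intro sum_mono) auto
    then show ?thesis using sqW kN\<tau> by (simp add: Q_def)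
  qed
  have et: "eps * \<tau> \<le> \<tau> / 400" using mult_right_mono[OF eps_bounds(2) \<tau>0] by simp
  have P0: "0 \<le> P" using g by (auto simp: P_def intro!: divide_nonneg_pos add_nonneg_nonneg sum_nonneg)
  have P3: "P \<le> 3 * \<tau>" using PQ Q2 et by linarith
  have P12: "P \<le> 1 / 2" using P3 \<tau>e eps_bounds by linarith
  define g' where "g' = real (card (graphs V d'))"
  have gg: "(k + 1) * g' = g * (1 - P)"
  proof -
    have "X / g * g = X" for X using g by simp
    then have "P * g = c {{b, a}} + (\<Sum>x\<in>W. c {{x, a}, {b, x}})" by (simp only: P_def)
    then have "g - (c {{b, a}} + (\<Sum>x\<in>W. c {{x, a}, {b, x}})) = g * (1 - P)"
      by (simp add: right_diff_distrib mult.commute)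
    with merge_count[OF V db] show ?thesis by (simp add: g'_def d'_def k_def g_def W_def)
  qed
  have "0 < (k + 1) * g'" unfolding gg using g P12 by (intro mult_pos_pos) auto
  then have g'0: "0 < g'" using k by (simp add: zero_less_mult_iff)
  then show "0 < card (graphs V d')" by (simp add: g'_def)
  have lnP: "\<bar>ln (1 - P) + P\<bar> \<le> 18 * (eps * \<tau>)"
  proof -
    have "\<bar>ln (1 + (- P)) - (- P)\<bar> \<le> 2 * (- P)\<^sup>2"
      using P0 P12 by (intro abs_ln_one_plus_x_minus_x_bound) auto
    then have "\<bar>ln (1 - P) + P\<bar> \<le> 2 * (P * P)" by (simp add: power2_eq_square)
    also have "P * P \<le> (3 * eps) * (3 * \<tau>)" using P0 P3 \<tau>e eps_bounds by (intro mult_mono) auto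
    finally show ?thesis by simp
  qed
  have "ln (k + 1) + ln g' = ln ((k + 1) * g')" using k g'0 by (simp add: ln_mult)
  also have "\<dots> = ln g + ln (1 - P)" unfolding gg using g P12 by (simp add: ln_mult)
  finally have L: "ln (k + 1) + ln g' = ln g + ln (1 - P)" .
  define F where "F x = ln (1 + (k + 1) * real (d x) / N) - ln (1 + k * real (d x) / N) - ln (1 + real (d x) / N)" for x
  have T: "exponent N V d' - exponent N V d = k / N - ln (1 + k / N) + (\<Sum>x\<in>W. F x)"
    using exponent_merge[where d = d and N = N, OF finite_V V db] by (simp add: d'_def k_def F_def W_def)
  have sF: "\<bar>(\<Sum>x\<in>W. F x) + (\<Sum>x\<in>W. q x) + (\<Sum>x\<in>W. k * real (d x) / N\<^sup>2)\<bar> \<le> 5 * (eps * \<tau>)"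
  proof -
    have "\<bar>\<Sum>x\<in>W. (F x + q x + k * real (d x) / N\<^sup>2)\<bar> \<le> (\<Sum>x\<in>W. \<bar>F x + q x + k * real (d x) / N\<^sup>2\<bar>)"
      by (rule sum_abs)
    also have "\<dots> \<le> (\<Sum>x\<in>W. 5 * eps * (k * (real (d x))\<^sup>2 / N\<^sup>2))"
    proof (intro sum_mono)
      fix x assume "x \<in> W"
      then have "real (d x) / N \<le> eps"
        using W N_pos D_div_N_le_eps divide_right_mono[OF d_le_D[of x], of N] by auto
      then show "\<bar>F x + q x + k * real (d x) / N\<^sup>2\<bar> \<le> 5 * eps * (k * (real (d x))\<^sup>2 / N\<^sup>2)"
        unfolding F_def q_def using N_pos k kN eps_bounds
        by (intro ln_ratio_expansion) (auto simp: Suc_le_eq)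
    qed
    also have "\<dots> = 5 * eps * (\<Sum>x\<in>W. k * (real (d x))\<^sup>2 / N\<^sup>2)" by (simp only: sum_distrib_left)
    also have "\<dots> \<le> 5 * eps * \<tau>" using eps_bounds sqW by (intro mult_left_mono) auto
    finally show ?thesis by (simp add: sum.distrib)
  qed
  \<comment> \<open>The vertices in \<open>W\<close> have total degree N - (k + 1), so the
    remainders k t / N^2 of the expansion add up to nearly k/N.\<close>
  have sd: "\<bar>(\<Sum>x\<in>W. k * real (d x) / N\<^sup>2) - k / N\<bar> \<le> eps * \<tau>"
  proof -
    have "N = k + 1 + (\<Sum>x\<in>W. real (d x))"
      unfolding sum_d[symmetric] W(5) using W V db by (simp add: k_def)
    then have "(\<Sum>x\<in>W. real (d x)) = N - (k + 1)" by simp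
    then have "(\<Sum>x\<in>W. k * real (d x) / N\<^sup>2) = k * (N - (k + 1)) / N\<^sup>2"
      by (simp flip: sum_distrib_left sum_divide_distrib)
    also have "\<dots> = k / N - (k / N) * ((k + 1) / N)"
      using N_pos by (simp add: power2_eq_square right_diff_distrib diff_divide_distrib)
    finally have "(\<Sum>x\<in>W. k * real (d x) / N\<^sup>2) - k / N = - ((k / N) * ((k + 1) / N))" by simp
    moreover have "(k / N) * ((k + 1) / N) \<le> \<tau> * eps"
    proof (intro mult_mono kN\<tau>)
      have "(k + 1) / N \<le> D / N" using k N_pos by (intro divide_right_mono) auto
      then show "(k + 1) / N \<le> eps" using D_div_N_le_eps by linarith
    qed (use k N_pos \<tau>0 in auto)
    moreover have "0 \<le> (k / N) * ((k + 1) / N)" using k N_pos by simp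
    ultimately show ?thesis by (simp add: mult.commute)
  qed
  have lk: "\<bar>ln (1 + k / N) - k / N\<bar> \<le> eps * \<tau>"
  proof -
    have "\<bar>ln (1 + k / N) - k / N\<bar> \<le> (k / N)\<^sup>2"
      using kN eps_bounds by (intro abs_ln_one_plus_x_minus_x_bound_nonneg) auto
    also have "\<dots> \<le> eps * \<tau>" unfolding power2_eq_square using kN kN\<tau> eps_bounds by (intro mult_mono) auto
    finally show ?thesis .
  qed
  \<comment> \<open>7 = 5 + 1 + 1. Two losses of about k/N, from ln (1 + k/N) and from the
    remainders, face the gain k/N from M2; the loss left over matches the edge term of
    \<open>Q\<close>.\<close>
  have "\<bar>exponent N V d' - exponent N V d + Q\<bar> \<le> 7 * (eps * \<tau>)"
    unfolding T Q_def using sF sd lk by linarith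
  then have "\<bar>(ln (k + 1) + ln g' - exponent N V d') - (ln g - exponent N V d)\<bar> \<le> 267 * (eps * \<tau>)"
    using L lnP PQ by linarith
  also have "\<dots> \<le> 300 * eps * \<tau>" using eps_bounds \<tau>0 by simp
  finally show "\<bar>(ln (real (d a) + 1) + ln (real (card (graphs V d'))) - exponent N V d') -
      (ln (real (card (graphs V d))) - exponent N V d)\<bar> \<le> 300 * eps * (real (d a) * D\<^sup>2 / N\<^sup>2)"
    by (simp add: k_def g'_def g_def c_empty \<tau>_def)
qed

end

section \<open>Perfect matchings\<close>

lemma Phi_card_Suc_Suc:
  assumes "even m"
  shows "Phi_card (m + 2) = (real m + 1) * Phi_card m"
proof -
  obtain j where m: "m = 2 * j" using assms by (elim evenE)
  have "Phi_card (2 * j + 2) = fact (2 * j + 2) / (2 ^ Suc j * fact (Suc j))"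
    unfolding Phi_card_def by simp
  moreover have "fact (2 * j + 2) = (2 * real j + 2) * ((2 * real j + 1) * fact (2 * j))"
    by (simp add: algebra_simps)
  moreover have "(2::real) ^ Suc j * fact (Suc j) = (2 * real j + 2) * (2 ^ j * fact j)"
    by (simp add: algebra_simps)
  ultimately have "Phi_card (2 * j + 2) = (2 * real j + 2) * ((2 * real j + 1) * fact (2 * j)) /
      ((2 * real j + 2) * (2 ^ j * fact j))" by (simp only:)
  also have "\<dots> = (2 * real j + 1) * fact (2 * j) / (2 ^ j * fact j)"
    by (rule mult_divide_mult_cancel_left) simp
  finally show ?thesis by (simp add: Phi_card_def m)
qed

lemma edge_pairs_mono: "U \<subseteq> V \<Longrightarrow> edge_pairs U \<subseteq> edge_pairs V"
  unfolding edge_pairs_def by blast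

lemma card_matchings_containing:
  assumes V: "u \<in> V" "v \<in> V" "u \<noteq> v"
  shows "card {E \<in> graphs V (\<lambda>_. 1). {v, u} \<in> E} = card (graphs (V - {u, v}) (\<lambda>_. 1))"
proof -
  have del: "E - {{v, u}} \<in> graphs (V - {u, v}) (\<lambda>_. 1)"
    if E: "E \<in> graphs V (\<lambda>_. 1)" and vu: "{v, u} \<in> E" for E
  proof -
    have uniq: "e = {v, u}" if "e \<in> E" "i \<in> e" "i = u \<or> i = v" for e i
    proof -
      have "card {e \<in> E. i \<in> e} = 1" using E V that by (auto simp: graphs_def deg_def)
      then obtain e0 where "{e \<in> E. i \<in> e} = {e0}" by (rule card_1_singletonE)
      moreover have "e \<in> {e \<in> E. i \<in> e}" "{v, u} \<in> {e \<in> E. i \<in> e}" using that vu by auto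
      ultimately show ?thesis by (metis singletonD)
    qed
    have "E - {{v, u}} \<subseteq> edge_pairs (V - {u, v})"
    proof
      fix e assume e: "e \<in> E - {{v, u}}"
      then obtain i j where ij: "i \<in> V" "j \<in> V" "i \<noteq> j" "e = {i, j}"
        using graphs_edgeE[OF E] by blast
      then have "i \<notin> {u, v}" "j \<notin> {u, v}" using e uniq[of e i] uniq[of e j] by auto
      with ij show "e \<in> edge_pairs (V - {u, v})" by simp
    qed
    moreover have "deg (E - {{v, u}}) i = 1" if "i \<in> V - {u, v}" for i
    proof -
      have "{e \<in> E - {{v, u}}. i \<in> e} = {e \<in> E. i \<in> e}" using that by auto
      then show ?thesis using E that by (simp add: graphs_def deg_def)
    qed
    ultimately show ?thesis by (simp add: graphs_def)
  qed
  have ins: "insert {v, u} E \<in> graphs V (\<lambda>_. 1) \<and> {v, u} \<notin> E" if E: "E \<in> graphs (V - {u, v}) (\<lambda>_. 1)" for E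
  proof -
    have sub: "E \<subseteq> edge_pairs (V - {u, v})" using E by (simp add: graphs_def)
    then have out: "i \<notin> {u, v}" if "e \<in> E" "i \<in> e" for e i
      using that by (fastforce simp: edge_pairs_def)
    have "deg (insert {v, u} E) i = 1" if "i \<in> V" for i
    proof (cases "i \<in> {u, v}")
      case True
      then have "{e \<in> insert {v, u} E. i \<in> e} = {{v, u}}" using out by auto
      then show ?thesis by (simp add: deg_def)
    next
      case False
      then have "{e \<in> insert {v, u} E. i \<in> e} = {e \<in> E. i \<in> e}" by auto
      then show ?thesis using E that False by (simp add: graphs_def deg_def)
    qed
    moreover have "insert {v, u} E \<subseteq> edge_pairs V"
      using sub V edge_pairs_mono[of "V - {u, v}" V] by auto
    moreover have "{v, u} \<notin> E" using out[of "{v, u}" u] by auto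
    ultimately show ?thesis by (simp add: graphs_def)
  qed
  have "bij_betw (\<lambda>E. E - {{v, u}}) {E \<in> graphs V (\<lambda>_. 1). {v, u} \<in> E} (graphs (V - {u, v}) (\<lambda>_. 1))"
    by (rule bij_betw_byWitness[where f' = "insert {v, u}"]) (use del ins in auto)
  then show ?thesis by (rule bij_betw_same_card)
qed

text \<open>Sorting the matchings by the partner of a fixed vertex gives \<open>card V - 1\<close>
  classes of equal size, which is the recursion of \<open>Phi_card\<close>.\<close>

lemma card_matchings:
  assumes "finite V" "even (card V)"
  shows "real (card (graphs V (\<lambda>_. 1))) = Phi_card (card V)"
  using assms
proof (induction "card V" arbitrary: V rule: less_induct)
  case less
  show ?case
  proof (cases "V = {}")
    case True
    have "edge_pairs ({} :: 'a set) = {}" by (auto simp: edge_pairs_def)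
    then have "graphs ({} :: 'a set) (\<lambda>_. 1) = {{}}" by (auto simp: graphs_def)
    then show ?thesis unfolding True by (simp add: Phi_card_def)
  next
    case False
    then obtain v where v: "v \<in> V" by blast
    have c2: "2 \<le> card V" using False less.prems by (cases "card V") (auto simp: card_gt_0_iff elim: oddE)
    then obtain m where m: "card V = m + 2" by (metis le_add_diff_inverse2)
    have "real (card (graphs V (\<lambda>_. 1))) = (\<Sum>E\<in>graphs V (\<lambda>_. 1). real (card {u \<in> V. {v, u} \<in> E}))"
    proof -
      have "card {u \<in> V. {v, u} \<in> E} = 1" if E: "E \<in> graphs V (\<lambda>_. 1)" for E
      proof -
        have "{u \<in> V. {v, u} \<in> E} = nbrs E v" using E by (auto simp: nbrs_def dest: graphs_edgeD)
        then show ?thesis using card_nbrs[OF E v] by simp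
      qed
      then show ?thesis by simp
    qed
    also have "\<dots> = (\<Sum>u\<in>V. real (card {E \<in> graphs V (\<lambda>_. 1). {v, u} \<in> E}))"
      using less.prems finite_graphs by (intro sum_card_swap) auto
    also have "\<dots> = (\<Sum>u\<in>V - {v}. real (card {E \<in> graphs V (\<lambda>_. 1). {v, u} \<in> E}))"
    proof -
      have none: "{E \<in> graphs V (\<lambda>_. 1). {v, v} \<in> E} = {}" by (auto dest: graphs_edgeD[of _ _ _ v v])
      show ?thesis unfolding sum.remove[OF less.prems(1) v] none by simp
    qed
    also have "\<dots> = (\<Sum>u\<in>V - {v}. Phi_card m)"
    proof (intro sum.cong refl)
      fix u assume u: "u \<in> V - {v}"
      then have cm: "card (V - {u, v}) = m" using v m less.prems by (subst card_Diff_subset) auto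
      have "real (card (graphs (V - {u, v}) (\<lambda>_. 1))) = Phi_card (card (V - {u, v}))"
        using cm m less.prems by (intro less.hyps) auto
      then show "real (card {E \<in> graphs V (\<lambda>_. 1). {v, u} \<in> E}) = Phi_card m"
        using card_matchings_containing[of u V v] u v cm by simp
    qed
    also have "\<dots> = (real m + 1) * Phi_card m" using v m less.prems by simp
    also have "\<dots> = Phi_card (card V)" using Phi_card_Suc_Suc[of m] m less.prems by simp
    finally show ?thesis .
  qed
qed

lemma Phi_card_pos: "0 < Phi_card m"
  by (simp add: Phi_card_def)

section \<open>The exponent of the perfect matching\<close>

lemma ln_one_plus_second_order:
  fixes x :: real
  assumes "0 \<le> x"
  shows "0 \<le> ln (1 + x) - x + x\<^sup>2 / 2" "ln (1 + x) - x + x\<^sup>2 / 2 \<le> x ^ 3 / 3"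
proof -
  have "(\<lambda>y. ln (1 + y) - y + y\<^sup>2 / 2) 0 \<le> (\<lambda>y. ln (1 + y) - y + y\<^sup>2 / 2) x"
  proof (rule DERIV_nonneg_imp_nondecreasing[OF assms])
    fix y :: real assume y: "0 \<le> y" "y \<le> x"
    have "((\<lambda>y. ln (1 + y) - y + y\<^sup>2 / 2) has_real_derivative y\<^sup>2 / (1 + y)) (at y)"
      using y by (auto intro!: derivative_eq_intros simp: field_simps power2_eq_square)
    moreover have "0 \<le> y\<^sup>2 / (1 + y)" using y by simp
    ultimately show "\<exists>z. ((\<lambda>y. ln (1 + y) - y + y\<^sup>2 / 2) has_real_derivative z) (at y) \<and> 0 \<le> z" by blast
  qed
  then show "0 \<le> ln (1 + x) - x + x\<^sup>2 / 2" by simp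
  have "(\<lambda>y. y ^ 3 / 3 - (ln (1 + y) - y + y\<^sup>2 / 2)) 0 \<le> (\<lambda>y. y ^ 3 / 3 - (ln (1 + y) - y + y\<^sup>2 / 2)) x"
  proof (rule DERIV_nonneg_imp_nondecreasing[OF assms])
    fix y :: real assume y: "0 \<le> y" "y \<le> x"
    have "((\<lambda>y. y ^ 3 / 3 - (ln (1 + y) - y + y\<^sup>2 / 2)) has_real_derivative y ^ 3 / (1 + y)) (at y)"
      using y by (auto intro!: derivative_eq_intros simp: field_simps power2_eq_square power3_eq_cube)
    moreover have "0 \<le> y ^ 3 / (1 + y)" using y by simp
    ultimately show "\<exists>z. ((\<lambda>y. y ^ 3 / 3 - (ln (1 + y) - y + y\<^sup>2 / 2)) has_real_derivative z) (at y) \<and> 0 \<le> z" by blast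
  qed
  then show "ln (1 + x) - x + x\<^sup>2 / 2 \<le> x ^ 3 / 3" by simp
qed

text \<open>The origin of - M1/2 + 3/4 in the formula. About N^2/2 pairs contribute ln (1 + 1/N)
  each, so an error O(1/N) requires the expansion up to second order; N (N - 1) / 2 times 1/N - 1/(2
  N^2) is N/2 - 3/4 + 1/(4 N).\<close>

lemma exponent_matching:
  fixes V :: "'a set"
  assumes "finite V" "V \<noteq> {}"
  defines "N \<equiv> real (card V)"
  shows "\<bar>exponent N V (\<lambda>_. 1) - (N / 2 - 3 / 4)\<bar> \<le> 1 / N"
proof -
  have N: "1 \<le> N" using assms by (simp add: N_def Suc_le_eq card_gt_0_iff)
  define R where "R = ln (1 + 1 / N) - 1 / N + (1 / N)\<^sup>2 / 2"
  have R: "0 \<le> R" "R \<le> (1 / N) ^ 3 / 3"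
    using ln_one_plus_second_order[of "1 / N"] N by (simp_all add: R_def)
  have "real (card V - 1) = N - 1" using N by (simp add: N_def of_nat_diff)
  then have "exponent N V (\<lambda>_. 1) = N * (N - 1) / 2 * ln (1 + 1 / N)"
    using assms(1) by (simp add: exponent_def pair_sum_def N_def)
  also have "\<dots> = N * (N - 1) / 2 * (1 / N - (1 / N)\<^sup>2 / 2) + N * (N - 1) / 2 * R"
    by (simp add: R_def algebra_simps)
  also have "N * (N - 1) / 2 * (1 / N - (1 / N)\<^sup>2 / 2) = N / 2 - 3 / 4 + 1 / (4 * N)"
    using N by (simp add: field_simps power2_eq_square)
  finally have "exponent N V (\<lambda>_. 1) - (N / 2 - 3 / 4) = 1 / (4 * N) + N * (N - 1) / 2 * R" by simp
  moreover have "0 \<le> N * (N - 1) / 2 * R" using N R by simp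
  moreover have "N * (N - 1) / 2 * R \<le> N * N / 2 * ((1 / N) ^ 3 / 3)"
    using N R by (intro mult_mono divide_right_mono) auto
  moreover have "N * N / 2 * ((1 / N) ^ 3 / 3) = 1 / (6 * N)" using N by (simp add: power3_eq_cube)
  moreover have "1 / (4 * N) + 1 / (6 * N) \<le> 1 / N" "0 \<le> 1 / (4 * N)" using N by (auto simp: field_simps)
  ultimately show ?thesis by linarith
qed

section \<open>Isolated vertices\<close>

lemma graphs_cong: "(\<And>i. i \<in> V \<Longrightarrow> d i = d' i) \<Longrightarrow> graphs V d = graphs V d'"
  by (auto simp: graphs_def)

lemma graphs_extend:
  assumes "finite V" "U \<subseteq> V" "\<And>i. i \<in> V - U \<Longrightarrow> d i = 0"
  shows "graphs V d = graphs U d"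
proof (intro equalityI subsetI)
  fix E assume E: "E \<in> graphs V d"
  have fin: "finite E" by (rule graphs_finite[OF assms(1) E])
  have "e \<in> edge_pairs U" if e: "e \<in> E" for e
  proof -
    obtain i j where ij: "i \<in> V" "j \<in> V" "i \<noteq> j" "e = {i, j}"
      using graphs_edgeE[OF E e] by blast
    have "w \<in> U" if "w \<in> e" "w \<in> V" for w
    proof (rule ccontr)
      assume "w \<notin> U"
      then have "card {e \<in> E. w \<in> e} = 0" using E that assms by (simp add: graphs_def deg_def)
      then show False using fin e that by auto
    qed
    with ij show ?thesis by simp
  qed
  then show "E \<in> graphs U d" using E assms by (auto simp: graphs_def)
next
  fix E assume E: "E \<in> graphs U d"
  have "E \<subseteq> edge_pairs V" using E edge_pairs_mono[OF assms(2)] by (auto simp: graphs_def)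
  moreover have "deg E i = d i" if i: "i \<in> V" for i
  proof (cases "i \<in> U")
    case True
    then show ?thesis using E by (simp add: graphs_def)
  next
    case False
    have "i \<notin> e" if "e \<in> E" for e using graphs_edgeE[OF E that] False by blast
    then have "{e \<in> E. i \<in> e} = {}" by blast
    then have "deg E i = 0" unfolding deg_def by (simp only: card.empty)
    then show ?thesis using assms(3)[of i] False i by simp
  qed
  ultimately show "E \<in> graphs V d" by (simp add: graphs_def)
qed

lemma exponent_cong: "(\<And>i. i \<in> V \<Longrightarrow> d i = d' i) \<Longrightarrow> exponent N V d = exponent N V d'"
  unfolding exponent_def by (auto intro!: arg_cong2[where f = "(+)"] pair_sum_cong arg_cong[where f = "\<lambda>x. x / (2 * N)"] sum.cong)

lemma exponent_extend:
  assumes "finite V" "U \<subseteq> V" "\<And>i. i \<in> V - U \<Longrightarrow> d i = 0"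
  shows "exponent N V d = exponent N U d"
proof -
  have "(\<Sum>i\<in>U. real (d i) * (real (d i) - 1)) = (\<Sum>i\<in>V. real (d i) * (real (d i) - 1))"
    using assms by (intro sum.mono_neutral_left) auto
  moreover have "pair_sum U f = pair_sum V f"
    if f: "f = (\<lambda>i j. ln (1 + real (d i) * real (d j) / N))" for f
  proof -
    have z: "f i j = 0 \<and> f j i = 0" if "j \<in> V - U" for i j
      using assms(3)[OF that] by (simp add: f)
    have "(\<Sum>j\<in>U - {i}. f i j) = (\<Sum>j\<in>V - {i}. f i j)" for i
      using assms(1,2) z by (intro sum.mono_neutral_left) auto
    moreover have "(\<Sum>i\<in>U. \<Sum>j\<in>V - {i}. f i j) = (\<Sum>i\<in>V. \<Sum>j\<in>V - {i}. f i j)"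
      using assms(1,2) z by (intro sum.mono_neutral_left) auto
    ultimately show ?thesis by (simp add: pair_sum_def)
  qed
  ultimately show ?thesis by (simp add: exponent_def)
qed

lemma pair_sum_atLeastAtMost:
  fixes f :: "nat \<Rightarrow> nat \<Rightarrow> real"
  assumes sym: "\<And>i j. f i j = f j i"
  shows "pair_sum {1..n} f = (\<Sum>(i, j)\<in>{(i, j). 1 \<le> i \<and> i < j \<and> j \<le> n}. f i j)"
proof (induction n)
  case 0
  have "{(i, j). 1 \<le> i \<and> i < j \<and> j \<le> (0::nat)} = {}" by auto
  then have "(\<Sum>(i, j)\<in>{(i, j). 1 \<le> i \<and> i < j \<and> j \<le> (0::nat)}. f i j) = 0" by (simp only: sum.empty)
  then show ?case by (simp add: pair_sum_def)
next
  case (Suc n)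
  let ?P = "\<lambda>n. {(i, j). 1 \<le> i \<and> i < j \<and> j \<le> (n::nat)}"
  have eq: "?P (Suc n) = ?P n \<union> (\<lambda>i. (i, Suc n)) ` {1..n}" by auto
  have fin: "finite (?P n)" by (rule finite_subset[of _ "{1..n} \<times> {1..n}"]) auto
  have "(\<Sum>(i, j)\<in>?P (Suc n). f i j) = (\<Sum>(i, j)\<in>?P n. f i j) + (\<Sum>(i, j)\<in>(\<lambda>i. (i, Suc n)) ` {1..n}. f i j)"
    unfolding eq by (rule sum.union_disjoint) (use fin in auto)
  also have "(\<Sum>(i, j)\<in>(\<lambda>i. (i, Suc n)) ` {1..n}. f i j) = (\<Sum>i\<in>{1..n}. f i (Suc n))"
    by (subst sum.reindex) (auto simp: inj_on_def)
  also have "\<dots> = (\<Sum>i\<in>{1..n}. f (Suc n) i)" by (intro sum.cong sym refl)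
  finally show ?case
    using pair_sum_insert[of "{1..n}" "Suc n" f, OF _ _ sym] Suc.IH by (simp add: atLeastAtMostSuc_conv)
qed

section \<open>From the perfect matching to a general degree sequence\<close>

text \<open>The logarithm of g(d) times the product of the d_i!, that is, of the number of perfect
  matchings on points, d_i of them at vertex i, that project to simple graphs. If all degrees are 1,
  this number is |\<Phi>|.\<close>

definition log_labelled_count :: "'a set \<Rightarrow> ('a \<Rightarrow> nat) \<Rightarrow> real" where
  "log_labelled_count V d = (\<Sum>i\<in>V. ln (fact (d i))) + ln (real (card (graphs V d)))"

lemma sum_two_points:
  fixes f :: "'a \<Rightarrow> 'b :: comm_monoid_add"
  assumes "finite V" "a \<in> V" "b \<in> V" "a \<noteq> b"
  shows "sum f V = f a + (f b + sum f (V - {a, b}))"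
proof -
  have "V = insert a (insert b (V - {a, b}))" using assms by auto
  then have "sum f V = sum f (insert a (insert b (V - {a, b})))" by (rule arg_cong)
  then show ?thesis using assms by simp
qed

text \<open>The induction runs against the mergers: a leaf is split off a vertex of degree at least
  2 and placed on an isolated one, which lowers the sum of squares. Merging it back costs a fixed
  factor times d_a - 1, exactly the change of the sum of d (d - 1) / 2, so the costs telescope.
  Existence of graphs is carried along because logarithms of counts are compared.\<close>

lemma log_count_deviation:
  fixes V :: "'a set" and d :: "'a \<Rightarrow> nat" and D :: real
  defines "N \<equiv> real (card V)"
  assumes V: "finite V" "V \<noteq> {}" "even (card V)" and D: "0 \<le> D" "400 * D ^ 3 \<le> N\<^sup>2"
    and d: "(\<Sum>i\<in>V. d i) = card V" "(\<Sum>i\<in>V. (real (d i))\<^sup>2) \<le> D\<^sup>2"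
  shows "0 < card (graphs V d) \<and>
    \<bar>(log_labelled_count V d - exponent N V d) - (ln (Phi_card (card V)) - exponent N V (\<lambda>_. 1))\<bar>
      \<le> 300 * (D ^ 3 / N\<^sup>2) * (D\<^sup>2 / N\<^sup>2) * (\<Sum>i\<in>V. real (d i) * (real (d i) - 1) / 2)"
  using d
proof (induction "\<Sum>i\<in>V. d i * d i" arbitrary: d rule: less_induct)
  case (less d)
  have N: "0 < N" using V by (simp add: N_def card_gt_0_iff)
  define B where "B = 300 * (D ^ 3 / N\<^sup>2) * (D\<^sup>2 / N\<^sup>2)"
  show ?case
  proof (cases "\<forall>i\<in>V. d i \<le> 1")
    case True
    have one: "d i = 1" if "i \<in> V" for i
    proof (rule ccontr)
      assume "d i \<noteq> 1"
      then have "d i < 1" using True that by (auto simp: le_less)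
      then have "(\<Sum>i\<in>V. d i) < (\<Sum>i\<in>V. 1)" using V True that by (intro sum_strict_mono_ex1) auto
      then show False using less.prems by simp
    qed
    have G: "graphs V d = graphs V (\<lambda>_. 1)" by (rule graphs_cong) (use one in auto)
    have X: "exponent N V d = exponent N V (\<lambda>_. 1)" by (rule exponent_cong) (use one in auto)
    have P: "real (card (graphs V d)) = Phi_card (card V)" unfolding G by (rule card_matchings[OF V(1,3)])
    have F: "(\<Sum>i\<in>V. ln (fact (d i))) = (0::real)" using one by (intro sum.neutral) auto
    have S: "(\<Sum>i\<in>V. real (d i) * (real (d i) - 1) / 2) = 0" using one by (intro sum.neutral) auto
    have "0 < card (graphs V d)" using P Phi_card_pos[of "card V"] by (metis of_nat_0_less_iff)
    then show ?thesis unfolding log_labelled_count_def F S X P by simp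
  next
    case False
    then obtain a where a: "a \<in> V" "2 \<le> d a" by (auto simp: not_le)
    \<comment> \<open>Pigeonhole: the degrees sum to the number of vertices and one of them exceeds
      1.\<close>
    have "\<exists>b\<in>V. d b = 0"
    proof (rule ccontr)
      assume "\<not> (\<exists>b\<in>V. d b = 0)"
      then have ge: "1 \<le> d b" if "b \<in> V" for b using that by (simp add: Suc_le_eq)
      have "\<exists>i\<in>V. 1 < d i" using a by (intro bexI[of _ a]) auto
      then have "(\<Sum>i\<in>V. 1) < (\<Sum>i\<in>V. d i)" using V ge by (intro sum_strict_mono_ex1) blast+
      then show False using less.prems by simp
    qed
    then obtain b where b: "b \<in> V" "d b = 0" by blast
    have ab: "a \<noteq> b" using a b by auto
    define e where "e = d(a := d a - 1, b := 1)"
    have ea: "e a = d a - 1" "e b = 1" and ew: "\<And>x. x \<in> V - {a, b} \<Longrightarrow> e x = d x"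
      using ab by (auto simp: e_def)
    have de: "d = e(a := e a + 1, b := 0)" using a b ab by (auto simp: e_def)
    note split = sum_two_points[OF V(1) a(1) b(1) ab]
    have W: "(\<Sum>x\<in>V - {a, b}. f (e x)) = (\<Sum>x\<in>V - {a, b}. f (d x))" for f :: "nat \<Rightarrow> real"
      using ew by (intro sum.cong) auto
    have Wn: "(\<Sum>x\<in>V - {a, b}. f (e x)) = (\<Sum>x\<in>V - {a, b}. f (d x))" for f :: "nat \<Rightarrow> nat"
      using ew by (intro sum.cong) auto
    have da: "real (e a) = real (d a) - 1" using a by (simp add: ea of_nat_diff)
    have sum_e: "(\<Sum>i\<in>V. e i) = card V"
      using less.prems(1) a b unfolding split[of e] split[of d] Wn[of "\<lambda>x. x"] by (simp add: ea)
    \<comment> \<open>Splitting d_a into d_a - 1 and 1 changes the sum of squares by 2 - 2 d_a < 0,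
      so the bound D^2 persists.\<close>
    have sq_e: "(\<Sum>i\<in>V. (real (e i))\<^sup>2) = (\<Sum>i\<in>V. (real (d i))\<^sup>2) - 2 * real (d a) + 2"
      using b unfolding split[of "\<lambda>i. (real (e i))\<^sup>2"] split[of "\<lambda>i. (real (d i))\<^sup>2"] W[of "\<lambda>x. (real x)\<^sup>2"]
      by (simp add: ea(2) da power2_eq_square algebra_simps)
    have sq_e': "(\<Sum>i\<in>V. (real (e i))\<^sup>2) \<le> D\<^sup>2" using sq_e less.prems(2) a by simp
    have dec: "(\<Sum>i\<in>V. e i * e i) < (\<Sum>i\<in>V. d i * d i)"
    proof -
      obtain j where j: "d a = j + 2" using a(2) by (metis le_add_diff_inverse2)
      show ?thesis
        using b unfolding split[of "\<lambda>i. e i * e i"] split[of "\<lambda>i. d i * d i"] Wn[of "\<lambda>x. x * x"]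
        by (simp add: ea j)
    qed
    note IH = less.hyps[OF dec sum_e sq_e']
    interpret S: sparse_degrees V e N D
    proof
      have "(\<Sum>i\<in>V. real (e i)) = real (\<Sum>i\<in>V. e i)" by simp
      also have "\<dots> = N" unfolding sum_e N_def ..
      finally show "(\<Sum>i\<in>V. real (e i)) = N" .
    qed (use V N D sq_e' in auto)
    have "(real (d a))\<^sup>2 \<le> (\<Sum>i\<in>V. (real (d i))\<^sup>2)" by (rule member_le_sum) (use a V in auto)
    also note less.prems(2)
    finally have "real (d a) \<le> D" by (rule power2_le_imp_le[OF _ D(1)])
    then have eD: "real (e a) + 1 \<le> D" using da by simp
    have e1: "1 \<le> e a" using a by (simp add: ea)
    note step = S.merge_step[OF a(1) b(1) ab ea(2) e1 eD, folded de]
    have pos: "0 < card (graphs V e)" using IH by blast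
    have F: "(\<Sum>i\<in>V. ln (fact (d i))) = (\<Sum>i\<in>V. ln (fact (e i))) + ln (real (e a) + 1)"
    proof -
      have "fact (d a) = (real (e a) + 1) * fact (e a)"
        unfolding de using ab by (simp add: add.commute)
      then have "ln (fact (d a)) = ln (real (e a) + 1) + ln (fact (e a) :: real)" by (simp add: ln_mult)
      then show ?thesis
        unfolding split[of "\<lambda>i. ln (fact (e i))"] split[of "\<lambda>i. ln (fact (d i))"] W[of "\<lambda>x. ln (fact x)"]
        by (simp add: ea(2) b)
    qed
    have Q: "(\<Sum>i\<in>V. real (d i) * (real (d i) - 1) / 2) = (\<Sum>i\<in>V. real (e i) * (real (e i) - 1) / 2) + real (e a)"
      unfolding split[of "\<lambda>i. real (e i) * (real (e i) - 1) / 2"] split[of "\<lambda>i. real (d i) * (real (d i) - 1) / 2"]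
        W[of "\<lambda>x. real x * (real x - 1) / 2"]
      by (simp add: ea(2) b da field_simps)
    have "\<bar>(ln (real (e a) + 1) + ln (real (card (graphs V d))) - exponent N V d) -
      (ln (real (card (graphs V e))) - exponent N V e)\<bar> \<le> B * real (e a)"
      using step(2)[OF pos] by (simp add: B_def S.eps_def mult_ac)
    then have "\<bar>(log_labelled_count V d - exponent N V d) - (log_labelled_count V e - exponent N V e)\<bar> \<le> B * real (e a)"
      unfolding log_labelled_count_def F by linarith
    moreover have "\<bar>(log_labelled_count V e - exponent N V e) - (ln (Phi_card (card V)) - exponent N V (\<lambda>_. 1))\<bar>
      \<le> B * (\<Sum>i\<in>V. real (e i) * (real (e i) - 1) / 2)" using IH by (simp add: B_def)
    ultimately have "\<bar>(log_labelled_count V d - exponent N V d) - (ln (Phi_card (card V)) - exponent N V (\<lambda>_. 1))\<bar>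
      \<le> B * (\<Sum>i\<in>V. real (d i) * (real (d i) - 1) / 2)"
      unfolding Q distrib_left by linarith
    with step(1)[OF pos] show ?thesis by (simp add: B_def)
  qed
qed

section \<open>Comparison with the asymptotic formula\<close>

lemma fall_2: "fall x 2 = real x * (real x - 1)"
  by (simp add: fall_def numeral_2_eq_2 lessThan_Suc)

lemma Mk_2_nonneg: "0 \<le> Mk n d 2"
proof -
  have "0 \<le> real x * (real x - 1)" for x :: nat by (cases x) auto
  then show ?thesis unfolding Mk_def fall_2 by (intro sum_nonneg)
qed

lemma fall_3: "fall x 3 = real x * (real x - 1) * (real x - 2)"
  by (simp add: fall_def numeral_3_eq_3 lessThan_Suc)

lemma Mk_1: "Mk n d 1 = real (\<Sum>i\<in>{1..n}. d i)"
  by (simp add: Mk_def fall_def)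

lemma fall_3_bounds: "0 \<le> fall x 3" "fall x 3 \<le> real x ^ 3"
proof -
  have "x = 0 \<or> x = 1 \<or> 2 \<le> x" by linarith
  then show "0 \<le> fall x 3" by (auto simp: fall_3)
  have "real x ^ 3 - fall x 3 = real x * (3 * real x - 2)"
    by (simp add: fall_3 power3_eq_cube algebra_simps)
  moreover have "0 \<le> real x * (3 * real x - 2)" by (cases "x = 0") auto
  ultimately show "fall x 3 \<le> real x ^ 3" by linarith
qed

lemma num_graphs_eq: "num_graphs n d = card (graphs {1..n} d)"
  by (simp add: num_graphs_def graphs_def pairs_def edge_pairs_def deg_def)

lemma abs_exp_minus_one_le:
  fixes x :: real
  assumes "\<bar>x\<bar> \<le> 1 / 2"
  shows "\<bar>exp x - 1\<bar> \<le> 2 * \<bar>x\<bar>"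
proof -
  have 1: "1 + x \<le> exp x" by (rule exp_ge_add_one_self)
  have "1 - x \<le> exp (- x)" using exp_ge_add_one_self[of "- x"] by simp
  then have "exp x * (1 - x) \<le> exp x * exp (- x)" by (intro mult_left_mono) auto
  then have "exp x * (1 - x) \<le> 1" by (simp flip: exp_add)
  then have "exp x \<le> 1 / (1 - x)" using assms by (subst pos_le_divide_eq) auto
  also have "\<dots> \<le> 1 + 2 * \<bar>x\<bar>"
  proof -
    have "1 \<le> (1 + 2 * \<bar>x\<bar>) * (1 - x)"
    proof (cases "0 \<le> x")
      case True
      then have "(1 + 2 * \<bar>x\<bar>) * (1 - x) = 1 + x * (1 - 2 * x)" by (simp add: algebra_simps)
      then show ?thesis using True assms by simp
    next
      case False
      then have "1 * 1 \<le> (1 + 2 * \<bar>x\<bar>) * (1 - x)" by (intro mult_mono) auto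
      then show ?thesis by simp
    qed
    then show ?thesis using assms by (subst pos_divide_le_eq) auto
  qed
  finally show ?thesis using 1 by linarith
qed

text \<open>N \<le> D^2 makes D^4/N^2 at least 1. It lets single errors of size D^3/N^2 be absorbed
  in the accumulated D^7/N^4.\<close>

lemma cube_ratio_le:
  fixes D N :: real
  assumes "0 \<le> D" "0 < N" "N \<le> D\<^sup>2"
  shows "D ^ 3 / N\<^sup>2 \<le> D ^ 7 / N ^ 4"
proof -
  have "N\<^sup>2 \<le> (D\<^sup>2)\<^sup>2" using assms by (intro power_mono) auto
  then have "1 \<le> D ^ 4 / N\<^sup>2" using assms by (simp flip: power_mult)
  then have "D ^ 3 / N\<^sup>2 * 1 \<le> D ^ 3 / N\<^sup>2 * (D ^ 4 / N\<^sup>2)"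
    using assms by (intro mult_left_mono) auto
  then show ?thesis by (simp flip: power_add)
qed

text \<open>With \<eta> = D^7/N^4, the logarithmic error is 150 \<eta> from the mergers, since M2
  \<le> D^2, plus at most \<eta> each from the 1/N of the matching exponent and from M3 / (3 N^2).
  Exponentiating doubles 152 to 304.\<close>

lemma approx_g_error:
  fixes d :: "nat \<Rightarrow> nat" and n :: nat and D :: real
  defines "N \<equiv> Mk n d 1"
  assumes d: "\<And>i. i \<in> {1..n} \<Longrightarrow> 1 \<le> d i" and ev: "even (\<Sum>i\<in>{1..n}. d i)" and n: "1 \<le> n"
    and D: "0 \<le> D" "D\<^sup>2 = Mk n d 1 + Mk n d 2" "400 * D ^ 3 \<le> N\<^sup>2"
    and small: "152 * (D ^ 7 / N ^ 4) \<le> 1 / 2"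
  shows "\<bar>real (num_graphs n d) - approx_g n d\<bar> \<le> 304 * (D ^ 7 / N ^ 4) * approx_g n d"
proof -
  define U where "U = {1..n}"
  define M where "M = (\<Sum>i\<in>U. d i)"
  \<comment> \<open>Positive degrees give n \<le> M, so this set contains the original vertices;
    with the added isolated ones the number of vertices equals the total degree.\<close>
  define V where "V = {1..M}"
  define e where "e i = (if i \<in> U then d i else 0)" for i
  have N: "N = real M" unfolding N_def Mk_1 M_def U_def ..
  have nM: "n \<le> M"
  proof -
    have "(\<Sum>i\<in>U. 1) \<le> M" unfolding M_def using d by (intro sum_mono) (auto simp: U_def)
    then show ?thesis by (simp add: U_def)
  qed
  have UV: "U \<subseteq> V" using nM by (auto simp: U_def V_def)
  have N1: "1 \<le> N" using nM n by (simp add: N)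
  have cV: "card V = M" by (simp add: V_def)
  have V: "finite V" "V \<noteq> {}" "even (card V)"
    using nM n ev by (auto simp: V_def M_def U_def)
  have e0: "\<And>i. i \<in> V - U \<Longrightarrow> e i = 0" by (simp add: e_def)
  have eU: "\<And>i. i \<in> U \<Longrightarrow> e i = d i" by (simp add: e_def)
  have ext: "(\<Sum>i\<in>V. f (e i)) = (\<Sum>i\<in>U. f (d i))" if "f 0 = 0" for f :: "nat \<Rightarrow> real"
  proof -
    have "(\<Sum>i\<in>U. f (d i)) = (\<Sum>i\<in>U. f (e i))" by (rule sum.cong) (auto simp: eU)
    also have "\<dots> = (\<Sum>i\<in>V. f (e i))" using V UV e0 that by (intro sum.mono_neutral_left) auto
    finally show ?thesis by simp
  qed
  have "real (\<Sum>i\<in>V. e i) = real (card V)"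
    using ext[of real] by (simp add: cV M_def)
  then have sum_e: "(\<Sum>i\<in>V. e i) = card V" by (simp only: of_nat_eq_iff)
  have D2: "(\<Sum>i\<in>U. (real (d i))\<^sup>2) = D\<^sup>2"
    unfolding D(2) Mk_1 by (simp add: Mk_def[of _ _ 2] fall_2 U_def power2_eq_square algebra_simps flip: sum.distrib)
  have sq_e: "(\<Sum>i\<in>V. (real (e i))\<^sup>2) \<le> D\<^sup>2" using ext[of "\<lambda>x. (real x)\<^sup>2"] D2 by simp
  have M2: "(\<Sum>i\<in>V. real (e i) * (real (e i) - 1) / 2) = Mk n d 2 / 2"
    using ext[of "\<lambda>x. real x * (real x - 1) / 2"] by (simp add: Mk_def fall_2 U_def sum_divide_distrib)
  have G: "card (graphs V e) = num_graphs n d"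
  proof -
    have "graphs V e = graphs U e" by (rule graphs_extend[OF V(1) UV]) (rule e0)
    also have "\<dots> = graphs U d" by (rule graphs_cong) (rule eU)
    finally show ?thesis by (simp add: num_graphs_eq U_def)
  qed
  have X: "exponent N V e = exponent N U d"
  proof -
    have "exponent N V e = exponent N U e" by (rule exponent_extend[OF V(1) UV]) (rule e0)
    also have "\<dots> = exponent N U d" by (rule exponent_cong) (rule eU)
    finally show ?thesis .
  qed
  have "exponent N U d = Mk n d 2 / (2 * N) + (\<Sum>(i,j)\<in>{(i,j). 1 \<le> i \<and> i < j \<and> j \<le> n}. ln (1 + lam n d i j))"
    unfolding exponent_def U_def
    by (subst pair_sum_atLeastAtMost) (auto simp: Mk_def[of _ _ 2] fall_2 lam_def N_def mult.commute)
  note X = X[unfolded this]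
  have Ffact: "(\<Sum>i\<in>V. ln (fact (e i))) = (\<Sum>i\<in>U. ln (fact (d i)) :: real)"
    using ext[of "\<lambda>x. ln (fact x)"] by simp
  define \<eta> where "\<eta> = D ^ 7 / N ^ 4"
  note dev = log_count_deviation[OF V D(1) D(3)[unfolded N, folded cV] sum_e sq_e, unfolded cV, folded N]
  have pos: "0 < num_graphs n d" using dev unfolding G by blast
  have ND: "N \<le> D\<^sup>2"
    using Mk_2_nonneg[of n d] unfolding D(2) N_def by simp
  have D1: "1 \<le> D"
  proof (rule ccontr)
    assume "\<not> 1 \<le> D"
    then have "D\<^sup>2 < 1" using D(1) by (simp add: power_less_one_iff)
    with ND N1 show False by linarith
  qed
  have M2le: "Mk n d 2 \<le> D\<^sup>2" using D(2) N1 by (simp add: N_def)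
  have t1: "300 * (D ^ 3 / N\<^sup>2) * (D\<^sup>2 / N\<^sup>2) * (Mk n d 2 / 2) \<le> 150 * \<eta>"
  proof -
    have "300 * (D ^ 3 / N\<^sup>2) * (D\<^sup>2 / N\<^sup>2) * (Mk n d 2 / 2) \<le> 300 * (D ^ 3 / N\<^sup>2) * (D\<^sup>2 / N\<^sup>2) * (D\<^sup>2 / 2)"
      using M2le D(1) by (intro mult_left_mono) auto
    also have "\<dots> = 150 * \<eta>"
      by (simp add: \<eta>_def flip: power_add)
    finally show ?thesis .
  qed
  have D3: "D ^ 3 / N\<^sup>2 \<le> \<eta>"
    unfolding \<eta>_def by (rule cube_ratio_le) (use D(1) N1 ND in auto)
  have N1': "1 / N \<le> D ^ 3 / N\<^sup>2"
  proof -
    have "1 * N \<le> D * D\<^sup>2" using ND D1 N1 by (intro mult_mono) auto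
    then have "N / N\<^sup>2 \<le> D ^ 3 / N\<^sup>2" by (intro divide_right_mono) (auto simp: power2_eq_square power3_eq_cube)
    then show ?thesis using N1 by (simp add: power2_eq_square)
  qed
  \<comment> \<open>Every degree is at most D, so the sum of cubes is at most D times D^2; the M3
    term is thus of the size D^3/N^2 of one relative error.\<close>
  have M3: "0 \<le> Mk n d 3" "Mk n d 3 \<le> D ^ 3"
  proof -
    show "0 \<le> Mk n d 3" unfolding Mk_def by (intro sum_nonneg fall_3_bounds)
    have "Mk n d 3 \<le> (\<Sum>i\<in>U. real (d i) ^ 3)" unfolding Mk_def U_def by (intro sum_mono fall_3_bounds)
    also have "\<dots> \<le> (\<Sum>i\<in>U. D * (real (d i))\<^sup>2)"
    proof (intro sum_mono)
      fix i assume i: "i \<in> U"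
      have "(real (d i))\<^sup>2 \<le> (\<Sum>i\<in>U. (real (d i))\<^sup>2)" using i by (intro member_le_sum) (auto simp: U_def)
      then have "real (d i) \<le> D" unfolding D2 by (rule power2_le_imp_le[OF _ D(1)])
      then have "real (d i) * (real (d i))\<^sup>2 \<le> D * (real (d i))\<^sup>2" by (intro mult_right_mono) auto
      then show "real (d i) ^ 3 \<le> D * (real (d i))\<^sup>2" by (simp add: power2_eq_square power3_eq_cube)
    qed
    also have "\<dots> = D * D\<^sup>2" by (simp add: D2 flip: sum_distrib_left)
    finally show "Mk n d 3 \<le> D ^ 3" by (simp add: power2_eq_square power3_eq_cube)
  qed
  have M3': "Mk n d 3 / (3 * N\<^sup>2) \<le> D ^ 3 / N\<^sup>2" "0 \<le> Mk n d 3 / (3 * N\<^sup>2)"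
  proof -
    show "0 \<le> Mk n d 3 / (3 * N\<^sup>2)" using M3 by simp
    have "Mk n d 3 / (3 * N\<^sup>2) \<le> D ^ 3 / (3 * N\<^sup>2)" using M3 by (intro divide_right_mono) auto
    also have "\<dots> \<le> D ^ 3 / N\<^sup>2" using D(1) N1 by (intro divide_left_mono) auto
    finally show "Mk n d 3 / (3 * N\<^sup>2) \<le> D ^ 3 / N\<^sup>2" .
  qed
  define A where "A = - N / 2 + Mk n d 2 / (2 * N) - Mk n d 3 / (3 * N\<^sup>2) + 3/4
          + (\<Sum>(i,j)\<in>{(i,j). 1 \<le> i \<and> i < j \<and> j \<le> n}. ln (1 + lam n d i j))"
  have approx: "approx_g n d = Phi_card M / (\<Prod>i\<in>U. fact (d i)) * exp A"
    by (simp add: approx_g_def M_def U_def A_def N_def)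
  have prod_pos: "0 < (\<Prod>i\<in>U. fact (d i) :: real)" by (intro prod_pos) auto
  have approx_pos: "0 < approx_g n d" unfolding approx using Phi_card_pos[of M] prod_pos by simp
  have lnapprox: "ln (approx_g n d) = ln (Phi_card M) - (\<Sum>i\<in>U. ln (fact (d i))) + A"
  proof -
    have "ln (\<Prod>i\<in>U. fact (d i) :: real) = (\<Sum>i\<in>U. ln (fact (d i)))"
      by (rule ln_prod) (auto simp: U_def)
    then show ?thesis unfolding approx using Phi_card_pos[of M] prod_pos
      by (simp add: ln_mult ln_div)
  qed
  define \<delta> where "\<delta> = ln (real (num_graphs n d)) - ln (approx_g n d)"
  have match: "\<bar>exponent N V (\<lambda>_. 1) - (N / 2 - 3 / 4)\<bar> \<le> 1 / N"
    using exponent_matching[OF V(1,2)] by (simp add: cV N)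
  have dev': "\<bar>(log_labelled_count V e - exponent N V e) - (ln (Phi_card M) - exponent N V (\<lambda>_. 1))\<bar> \<le> 150 * \<eta>"
    using dev t1 unfolding M2 by linarith
  have "\<bar>\<delta>\<bar> \<le> 150 * \<eta> + 1 / N + Mk n d 3 / (3 * N\<^sup>2)"
    using dev' match M3'(2) unfolding \<delta>_def lnapprox A_def log_labelled_count_def X G Ffact
    by linarith
  then have \<delta>: "\<bar>\<delta>\<bar> \<le> 152 * \<eta>" using D3 N1' M3' by linarith
  then have "\<bar>exp \<delta> - 1\<bar> \<le> 304 * \<eta>"
    using abs_exp_minus_one_le[of \<delta>] small by (simp add: \<eta>_def)
  moreover have "real (num_graphs n d) = approx_g n d * exp \<delta>"
    unfolding \<delta>_def exp_diff using pos approx_pos by simp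
  then have "real (num_graphs n d) - approx_g n d = approx_g n d * (exp \<delta> - 1)" by (simp add: algebra_simps)
  then have "\<bar>real (num_graphs n d) - approx_g n d\<bar> = approx_g n d * \<bar>exp \<delta> - 1\<bar>"
    using approx_pos by (simp add: abs_mult)
  ultimately have "\<bar>real (num_graphs n d) - approx_g n d\<bar> \<le> approx_g n d * (304 * \<eta>)"
    using approx_pos by simp
  then show ?thesis by (simp add: \<eta>_def mult_ac)
qed

section \<open>Bounding the errors by \<xi>\<close>

lemma powr_eighth:
  fixes N :: real
  assumes "0 < N"
  shows "(N powr (1/8)) ^ k = N powr (real k / 8)"
  using assms by (simp add: powr_powr flip: powr_realpow)

text \<open>In terms of s = N^(1/8) all powers of N have integer exponents. The second bound yields
  \<xi> = o(1). The third controls the square of D^7/N^4: for M2 \<le> N it is at most 128/N,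
  otherwise at most 128 M2^7/N^8, which the first term of \<xi> dominates.\<close>

lemma xi_bounds:
  assumes N: "1 \<le> Mk n d 1" and M: "0 \<le> Mk n d 2" "Mk n d 2 \<le> Mk n d 1 powr (9/8)"
  shows "0 \<le> xi n d"
    and "xi n d \<le> 2 * (Mk n d 2 / Mk n d 1 powr (9/8)) + 1 / Mk n d 1"
    and "(Mk n d 1 + Mk n d 2) ^ 7 / Mk n d 1 ^ 8 \<le> 128 * xi n d"
proof -
  define N where "N = Mk n d 1"
  define M2 where "M2 = Mk n d 2"
  have N1: "1 \<le> N" and M0: "0 \<le> M2" and MN: "M2 \<le> N powr (9/8)"
    using N M by (simp_all add: N_def M2_def)
  define s where "s = N powr (1/8)"
  have s1: "1 \<le> s" using N1 by (simp add: s_def ge_one_powr_ge_zero)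
  have s8: "N = s ^ 8" and s9: "N powr (9/8) = s ^ 9" and s36: "N powr (9/2) = s ^ 36"
    using N1 by (simp_all add: s_def powr_eighth)
  define r where "r = M2 / s ^ 9"
  have r: "0 \<le> r" "r \<le> 1" using M0 MN s1 by (simp_all add: r_def s9)
  have Mr: "M2 = r * s ^ 9" using s1 by (simp add: r_def)
  have xi: "xi n d = M2 ^ 4 / s ^ 36 + M2 powr (3/2) / N\<^sup>2 + 1 / N"
    by (simp only: xi_def s36 flip: N_def M2_def)
  have a0: "0 \<le> M2 ^ 4 / s ^ 36" "0 \<le> M2 powr (3/2) / N\<^sup>2" "0 \<le> 1 / N" using s1 M0 N1 by auto
  then show "0 \<le> xi n d" by (simp add: xi)
  have "M2 ^ 4 / s ^ 36 = r ^ 4" using s1 by (simp add: Mr power_mult_distrib flip: power_mult)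
  also have "\<dots> \<le> r ^ 1" using r by (intro power_decreasing) auto
  finally have x1: "M2 ^ 4 / s ^ 36 \<le> r" by simp
  have x2: "M2 powr (3/2) / N\<^sup>2 \<le> r"
  proof -
    have "sqrt M2 \<le> s ^ 5"
    proof (rule real_le_lsqrt)
      have "M2 \<le> s ^ 9" using MN by (simp add: s9)
      also have "\<dots> \<le> s ^ 10" using s1 by (intro power_increasing) auto
      finally show "M2 \<le> (s ^ 5)\<^sup>2" by (simp flip: power_mult)
    qed (use M0 s1 in auto)
    then have "M2 * sqrt M2 \<le> M2 * s ^ 5" using M0 by (intro mult_left_mono)
    also have "\<dots> = r * s ^ 14" by (simp add: Mr flip: power_add)
    also have "\<dots> \<le> r * s ^ 16" using r s1 by (intro mult_left_mono power_increasing) auto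
    finally have "M2 * sqrt M2 \<le> r * N\<^sup>2" by (simp add: s8 flip: power_mult)
    moreover have "M2 powr (3/2) = M2 * sqrt M2"
      using powr_mult_base[of M2 "1/2"] M0 by (simp add: powr_half_sqrt)
    ultimately show ?thesis using N1 by (simp add: pos_divide_le_eq)
  qed
  show "xi n d \<le> 2 * (Mk n d 2 / Mk n d 1 powr (9/8)) + 1 / Mk n d 1"
    unfolding N_def[symmetric] M2_def[symmetric] s9 r_def[symmetric] xi using x1 x2 by simp
  have "(N + M2) ^ 7 / N ^ 8 \<le> 128 * xi n d"
  proof (cases "M2 \<le> N")
    case True
    then have "(N + M2) ^ 7 \<le> (2 * N) ^ 7" using M0 N1 by (intro power_mono) auto
    then have "(N + M2) ^ 7 / N ^ 8 \<le> (2 * N) ^ 7 / N ^ 8" by (rule divide_right_mono) (use N1 in auto)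
    also have "\<dots> = 128 * (1 / N)" using N1 by (simp add: power_mult_distrib power_numeral_reduce)
    also have "\<dots> \<le> 128 * xi n d" using a0 by (simp add: xi)
    finally show ?thesis .
  next
    case False
    then have "(N + M2) ^ 7 \<le> (2 * M2) ^ 7" using M0 N1 by (intro power_mono) auto
    then have "(N + M2) ^ 7 / N ^ 8 \<le> (2 * M2) ^ 7 / N ^ 8" by (rule divide_right_mono) (use N1 in auto)
    also have "\<dots> = 128 * M2 ^ 4 * M2 ^ 3 / s ^ 64"
      by (simp add: power_mult_distrib s8 flip: power_mult power_add)
    also have "\<dots> \<le> 128 * M2 ^ 4 * s ^ 28 / s ^ 64"
    proof (intro divide_right_mono mult_left_mono)
      \<comment> \<open>M2^3 \<le> N^(27/8) \<le> N^(7/2), and 8 - 7/2 = 9/2 is the exponent in the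
        first term of \<xi>.\<close>
      have "M2 ^ 3 \<le> (s ^ 9) ^ 3" using MN M0 by (intro power_mono) (auto simp: s9)
      also have "\<dots> \<le> s ^ 28" using s1 by (subst power_mult[symmetric], intro power_increasing) auto
      finally show "M2 ^ 3 \<le> s ^ 28" .
    qed (use M0 s1 in auto)
    also have "\<dots> = 128 * (M2 ^ 4 / s ^ 36)"
    proof -
      have "s ^ 64 = s ^ 36 * s ^ 28" by (simp flip: power_add)
      moreover have "128 * M2 ^ 4 * s ^ 28 / (s ^ 36 * s ^ 28) = 128 * M2 ^ 4 / s ^ 36"
        by (rule mult_divide_mult_cancel_right) (use s1 in auto)
      ultimately show ?thesis by (simp only: times_divide_eq_right)
    qed
    also have "\<dots> \<le> 128 * xi n d" using a0 by (simp add: xi)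
    finally show ?thesis .
  qed
  then show "(Mk n d 1 + Mk n d 2) ^ 7 / Mk n d 1 ^ 8 \<le> 128 * xi n d" by (simp add: N_def M2_def)
qed

text \<open>The constants: 128 \<le> 12^2 gives \<eta> \<le> 12 sqrt \<xi>. With sqrt \<xi> \<le>
  1/5000 this is at most 1/400, as the sparseness condition demands, and 152 \<eta> \<le> 1/2.
  Finally 304 * 12 \<le> 4000.\<close>

lemma num_graphs_approx:
  fixes d :: "nat \<Rightarrow> nat"
  assumes d: "\<And>i. i \<in> {1..n} \<Longrightarrow> 1 \<le> d i" and ev: "even (\<Sum>i\<in>{1..n}. d i)" and n: "1 \<le> n"
    and M2: "Mk n d 2 \<le> Mk n d 1 powr (9/8)" and small: "sqrt (xi n d) \<le> 1 / 5000"
  shows "\<bar>real (num_graphs n d) - approx_g n d\<bar> \<le> 4000 * sqrt (xi n d) * approx_g n d"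
proof -
  define N where "N = Mk n d 1"
  define D where "D = sqrt (Mk n d 1 + Mk n d 2)"
  define \<eta> where "\<eta> = D ^ 7 / N ^ 4"
  have M20: "0 \<le> Mk n d 2" by (rule Mk_2_nonneg)
  have N1: "1 \<le> N"
  proof -
    have "(\<Sum>i\<in>{1..n}. 1) \<le> (\<Sum>i\<in>{1..n}. d i)" using d by (intro sum_mono) auto
    then have "1 \<le> (\<Sum>i\<in>{1..n}. d i)" using n by simp
    then show ?thesis unfolding N_def Mk_1 by linarith
  qed
  have D2: "0 \<le> D" "D\<^sup>2 = Mk n d 1 + Mk n d 2" using N1 M20 by (auto simp: D_def N_def)
  have ND: "N \<le> D\<^sup>2" using D2 M20 by (simp add: N_def)
  note xb = xi_bounds[OF N1[unfolded N_def] M20 M2]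
  have \<eta>0: "0 \<le> \<eta>" using D2 N1 by (simp add: \<eta>_def)
  have "\<eta>\<^sup>2 = (D\<^sup>2) ^ 7 / N ^ 8" by (simp add: \<eta>_def power_divide flip: power_mult)
  also have "\<dots> \<le> 128 * xi n d" using xb(3) by (simp add: D2 N_def)
  also have "\<dots> \<le> (12 * sqrt (xi n d))\<^sup>2" using xb(1) by (simp add: power_mult_distrib)
  finally have \<eta>: "\<eta> \<le> 12 * sqrt (xi n d)" by (rule power2_le_imp_le) (use xb(1) in simp)
  have D3: "D ^ 3 / N\<^sup>2 \<le> \<eta>"
    unfolding \<eta>_def by (rule cube_ratio_le) (use D2 N1 ND in auto)
  then have "D ^ 3 / N\<^sup>2 \<le> 1 / 400" using \<eta> small by linarith
  then have s1: "400 * D ^ 3 \<le> N\<^sup>2" using N1 by (simp add: pos_divide_le_eq)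
  have s2: "152 * (D ^ 7 / N ^ 4) \<le> 1 / 2" using \<eta> small by (simp add: \<eta>_def)
  have main: "\<bar>real (num_graphs n d) - approx_g n d\<bar> \<le> 304 * \<eta> * approx_g n d"
    unfolding \<eta>_def N_def
    by (rule approx_g_error) (use d ev n D2 s1 s2 in \<open>simp_all add: N_def\<close>)
  have "0 \<le> approx_g n d"
    unfolding approx_g_def using Phi_card_pos by (intro mult_nonneg_nonneg divide_nonneg_nonneg prod_nonneg) (auto intro: less_imp_le)
  moreover have "304 * \<eta> \<le> 4000 * sqrt (xi n d)" using \<eta> real_sqrt_ge_zero[OF xb(1)] by linarith
  ultimately have "304 * \<eta> * approx_g n d \<le> 4000 * sqrt (xi n d) * approx_g n d" by (intro mult_right_mono)
  with main show ?thesis by linarith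
qed

text \<open>\<open>C\<close> is chosen before \<open>d\<close>, so the O-constant is uniform over
  all sequences; only the threshold for n depends on \<open>d\<close>.\<close>

theorem theorem2p1:
  "\<exists>C::real. \<forall>d :: nat \<Rightarrow> nat \<Rightarrow> nat.
     (\<forall>n. \<forall>i\<in>{1..n}. d n i \<ge> 1) \<longrightarrow>
     (\<forall>n. even (\<Sum>i\<in>{1..n}. d n i)) \<longrightarrow>
     (\<lambda>n. Mk n (d n) 2) \<in> o(\<lambda>n. Mk n (d n) 1 powr (9/8)) \<longrightarrow>
     ((\<lambda>n. xi n (d n)) \<longlonglongrightarrow> 0) \<and>
     (\<forall>\<^sub>F n in sequentially.
        \<bar>real (num_graphs n (d n)) - approx_g n (d n)\<bar>
          \<le> C * sqrt (xi n (d n)) * approx_g n (d n))"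
proof (rule exI[of _ 4000], intro allI impI)
  fix d :: "nat \<Rightarrow> nat \<Rightarrow> nat"
  assume d: "\<forall>n. \<forall>i\<in>{1..n}. d n i \<ge> 1" and ev: "\<forall>n. even (\<Sum>i\<in>{1..n}. d n i)"
    and o: "(\<lambda>n. Mk n (d n) 2) \<in> o(\<lambda>n. Mk n (d n) 1 powr (9/8))"
  have M20: "0 \<le> Mk n (d n) 2" for n by (rule Mk_2_nonneg)
  \<comment> \<open>Positive degrees force M1 \<ge> n, so the summand 1/M1 of \<xi> tends to
    0.\<close>
  have M1: "real n \<le> Mk n (d n) 1" for n
  proof -
    have "(\<Sum>i\<in>{1..n}. 1) \<le> (\<Sum>i\<in>{1..n}. d n i)" using d by (intro sum_mono) auto
    then have "n \<le> (\<Sum>i\<in>{1..n}. d n i)" by simp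
    then show ?thesis unfolding Mk_1 by (rule of_nat_mono)
  qed
  have E1: "\<forall>\<^sub>F n in sequentially. 1 \<le> n" by (rule eventually_ge_at_top)
  \<comment> \<open>The little-o hypothesis with constant 1; smallness of \<xi> itself is extracted
    later from its limit.\<close>
  have E2: "\<forall>\<^sub>F n in sequentially. Mk n (d n) 2 \<le> Mk n (d n) 1 powr (9/8)"
    using landau_o.smallD[OF o zero_less_one] by eventually_elim simp
  have E: "\<forall>\<^sub>F n in sequentially. 0 \<le> xi n (d n) \<and>
      xi n (d n) \<le> 2 * (Mk n (d n) 2 / Mk n (d n) 1 powr (9/8)) + 1 / real n"
    using E1 E2
  proof eventually_elim
    case (elim n)
    have N1: "1 \<le> Mk n (d n) 1" using M1[of n] elim(1) by linarith
    have "1 / Mk n (d n) 1 \<le> 1 / real n" using M1[of n] elim(1) by (intro divide_left_mono) auto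
    with xi_bounds(1,2)[OF N1 M20 elim(2)] show ?case by linarith
  qed
  have "(\<lambda>n. 2 * (Mk n (d n) 2 / Mk n (d n) 1 powr (9/8)) + 1 / real n) \<longlonglongrightarrow> 2 * 0 + 0"
    by (intro tendsto_intros smalloD_tendsto[OF o] lim_1_over_n)
  then have up: "(\<lambda>n. 2 * (Mk n (d n) 2 / Mk n (d n) 1 powr (9/8)) + 1 / real n) \<longlonglongrightarrow> 0"
    by (simp only: mult_zero_right add_0)
  have "\<forall>\<^sub>F n in sequentially. 0 \<le> xi n (d n)"
    "\<forall>\<^sub>F n in sequentially. xi n (d n) \<le> 2 * (Mk n (d n) 2 / Mk n (d n) 1 powr (9/8)) + 1 / real n"
    using E by (simp_all only: eventually_conj_iff)
  then have lim: "(\<lambda>n. xi n (d n)) \<longlonglongrightarrow> 0"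
    by (rule tendsto_sandwich[OF _ _ tendsto_const up])
  have "(\<lambda>n. sqrt (xi n (d n))) \<longlonglongrightarrow> sqrt 0" by (intro tendsto_real_sqrt lim)
  then have "\<forall>\<^sub>F n in sequentially. sqrt (xi n (d n)) < 1 / 5000"
    by (rule order_tendstoD) simp
  then have "\<forall>\<^sub>F n in sequentially. \<bar>real (num_graphs n (d n)) - approx_g n (d n)\<bar>
          \<le> 4000 * sqrt (xi n (d n)) * approx_g n (d n)"
    using E1 E2
  proof eventually_elim
    case (elim n)
    then show ?case using d ev by (intro num_graphs_approx) auto
  qed
  with lim show "((\<lambda>n. xi n (d n)) \<longlonglongrightarrow> 0) \<and>
     (\<forall>\<^sub>F n in sequentially. \<bar>real (num_graphs n (d n)) - approx_g n (d n)\<bar>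
          \<le> 4000 * sqrt (xi n (d n)) * approx_g n (d n))" by blast
qed

end
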